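(* Let $q$ be an odd prime power, $d\ge 0$, and let $(\mathbb F_q^{2d},\omega)$ be a symplectic space. Then $$\sum_{F\in\mathcal{WF}(\mathbb F_q^{2d},\omega)}t^{w(F)}=M_d^{\pm}\prod_{j=1}^d\frac{1}{1-t^j},\qquad M_d^\pm=\sum_{\sigma\in\mathcal S_d^{\pm}}q^{l^\pm(\sigma)}t^{\mathrm{Wmaj}(\sigma)}.$$
   Context: A subspace $L$ of the symplectic space (a $2d$-dimensional vector space with a non-degenerate alternating bilinear form $\omega$) is isotropic if $\omega$ vanishes on $L\times L$. A flag of $(\mathbb F_q^{2d},\omega)$ is a strictly increasing sequence $V_1\subset\dots\subset V_k$ ($k\ge0$) of nonzero isotropic subspaces; a weighted flag additionally carries strictly positive integers $w_1,\dots,w_k$ and has weight $w(F)=\sum_i w_i\dim V_i$; $\mathcal{WF}(\mathbb F_q^{2d},\omega)$ is the set of weighted flags. $\mathcal S_d^\pm$ is the group of permutations $\sigma$ of $\{\pm1,\dots,\pm d\}$ with $\sigma(-i)=-\sigma(i)$. For $\sigma\in\mathcal S_d^\pm$: $l^\pm(\sigma)=\#\{0<i<j\le d:\sigma(i)\sigma(j)(\sigma(i)-\sigma(j))>0\}+\sum_{1\le i\le d,\sigma(i)<0}(d+1+\sigma(i))$, and $\mathrm{Wmaj}(\sigma)=\sum_{1\le i<d,\ \sigma(i)>\sigma(i+1)}i+\#\{1\le i\le d:\sigma(i)<0\}$ (with the usual order on integers). *)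

theory Defs
  imports
    "HOL-Analysis.Infinite_Sum"
    "HOL-Combinatorics.Permutations"
    "HOL-Library.Cardinality"
begin

text \<open>
  The space is a carrier \<open>V\<close> inside an ambient vector space, so that every dimension \<open>2d\<close>,
  including \<open>0\<close>, can occur; \<open>\<omega>\<close> matters only on \<open>V\<close>. The dimension is fixed through
  a finite basis because \<open>dim\<close> is \<open>0\<close> on infinite-dimensional spaces.
\<close>

locale symplectic_space = vector_space scale
  for scale :: "'a::field \<Rightarrow> 'v::ab_group_add \<Rightarrow> 'v" +
  fixes V :: "'v set" and \<omega> :: "'v \<Rightarrow> 'v \<Rightarrow> 'a" and d :: nat
  assumes basis: "\<exists>B. finite B \<and> independent B \<and> span B = V \<and> card B = 2 * d"
    and add_left: "\<lbrakk>x \<in> V; y \<in> V; z \<in> V\<rbrakk> \<Longrightarrow> \<omega> (x + y) z = \<omega> x z + \<omega> y z"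
    and add_right: "\<lbrakk>x \<in> V; y \<in> V; z \<in> V\<rbrakk> \<Longrightarrow> \<omega> x (y + z) = \<omega> x y + \<omega> x z"
    and scale_left: "\<lbrakk>x \<in> V; y \<in> V\<rbrakk> \<Longrightarrow> \<omega> (scale c x) y = c * \<omega> x y"
    and scale_right: "\<lbrakk>x \<in> V; y \<in> V\<rbrakk> \<Longrightarrow> \<omega> x (scale c y) = c * \<omega> x y"
    and alternating: "x \<in> V \<Longrightarrow> \<omega> x x = 0"
    and nondegenerate: "\<lbrakk>x \<in> V; \<And>y. y \<in> V \<Longrightarrow> \<omega> x y = 0\<rbrakk> \<Longrightarrow> x = 0"
begin

definition isotropic :: "'v set \<Rightarrow> bool" where
  "isotropic L \<longleftrightarrow> subspace L \<and> L \<subseteq> V \<and> (\<forall>x\<in>L. \<forall>y\<in>L. \<omega> x y = 0)"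

definition flag :: "'v set list \<Rightarrow> bool" where
  "flag Vs \<longleftrightarrow> sorted_wrt (\<subset>) Vs \<and> (\<forall>U\<in>set Vs. isotropic U \<and> U \<noteq> {0})"

text \<open>A weighted flag is the list of pairs \<open>(V\<^sub>1, w\<^sub>1), \<dots>, (V\<^sub>k, w\<^sub>k)\<close>.\<close>

definition weighted_flags :: "('v set \<times> nat) list set" where
  "weighted_flags = {F. flag (map fst F) \<and> (\<forall>w\<in>set (map snd F). w > 0)}"

definition flag_weight :: "('v set \<times> nat) list \<Rightarrow> nat" where
  "flag_weight F = (\<Sum>(U, w)\<leftarrow>F. w * dim U)"

end

definition signed_perms :: "nat \<Rightarrow> (int \<Rightarrow> int) set" where
  "signed_perms d = {\<sigma>. \<sigma> permutes {i. i \<noteq> 0 \<and> \<bar>i\<bar> \<le> int d} \<and>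
     (\<forall>i. i \<noteq> 0 \<and> \<bar>i\<bar> \<le> int d \<longrightarrow> \<sigma> (- i) = - \<sigma> i)}"

text \<open>For a signed permutation every \<open>d + 1 + \<sigma> i\<close> is positive, so \<open>nat\<close> truncates nothing.\<close>

definition signed_length :: "nat \<Rightarrow> (int \<Rightarrow> int) \<Rightarrow> nat" where
  "signed_length d \<sigma> =
     card {(i, j). 0 < i \<and> i < j \<and> j \<le> int d \<and> \<sigma> i * \<sigma> j * (\<sigma> i - \<sigma> j) > 0} +
     (\<Sum>i | 1 \<le> i \<and> i \<le> int d \<and> \<sigma> i < 0. nat (int d + 1 + \<sigma> i))"

definition Wmaj :: "nat \<Rightarrow> (int \<Rightarrow> int) \<Rightarrow> nat" where
  "Wmaj d \<sigma> =
     (\<Sum>i | 1 \<le> i \<and> i < int d \<and> \<sigma> i > \<sigma> (i + 1). nat i) +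
     card {i. 1 \<le> i \<and> i \<le> int d \<and> \<sigma> i < 0}"

definition M_signed :: "nat \<Rightarrow> nat \<Rightarrow> rat fps" where
  "M_signed q d = (\<Sum>\<sigma>\<in>signed_perms d. of_nat q ^ signed_length d \<sigma> * fps_X ^ Wmaj d \<sigma>)"

end

theory Submission
  imports Defs "HOL-Combinatorics.Multiset_Permutations"
begin

text \<open>
  A weighted flag is a decreasing sequence of isotropic subspaces that is eventually zero, so
  splitting off its largest member gives
  \<open>H\<^sub>n = (\<Sum>m\<le>n. [n choose m]\<^sub>q t ^ m H\<^sub>m)\<close> for the series of flags inside an isotropic space of
  dimension \<open>n\<close>, and the full series is \<open>\<Sum>m\<le>d. I\<^sub>m t ^ m H\<^sub>m\<close>, where \<open>I\<^sub>m\<close> counts the isotropic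
  subspaces of dimension \<open>m\<close>.

  On the side of the group, reorder the letters as \<open>1 < \<dots> < d < - d < \<dots> < - 1\<close>, with a wall between
  \<open>d\<close> and \<open>- d\<close> appended to every word. Then \<open>l\<^sup>\<plusminus>\<close> is the number of inversions plus the distances of
  the letters above the wall from it, and \<open>Wmaj\<close> is the ordinary major index. Summing over all
  ways to cut a word before a sorted suffix telescopes (lemma \<open>sum_sorted_suffixes\<close>) and yields the
  same two recursions, with \<open>q\<close>-counted subsets in place of subspaces.
\<close>

section \<open>Inversions and major index of words\<close>

text \<open>In the recursion for \<open>H\<^sub>n\<close> the term m = n contains the unknown
  itself, so the recursion is used with 1 - t^n in front of the unknown, and this factor is
  cancelled. The flag series has the denominator (1 - t) ... (1 - t^n). Clearing it leaves beside
  the m-th term exactly the factors 1 - t^j with m < j \<le> n, and these are the factors that the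
  cuts of a word produce. The coefficients are compared without division. Subsets weighted by
  inversions and subspaces of dimension m satisfy the same identity once both are multiplied by the
  product of q^m - q^i over i < m, the number of ordered bases of an m-dimensional space. That
  product can be cancelled because q^n = 1 only for n = 0. Isotropic subspaces are matched in the
  same way with pairs of blocks of signed letters. No bijection between words and flags is built;
  equality follows from equal recursions.\<close>

definition maj :: "'a::linorder list \<Rightarrow> nat" where
  "maj w = (\<Sum>i | Suc i < length w \<and> w ! Suc i < w ! i. Suc i)"

definition inversions :: "'a::linorder list \<Rightarrow> nat" where
  "inversions w = card {(i, j). i < j \<and> j < length w \<and> w ! j < w ! i}"

text \<open>Inversions between a front and a rear block depend only on the two letter sets, whatever
  the order inside the blocks. This turns sums over cut words into sums over subsets.\<close>

definition cross_inversions :: "'a::linorder set \<Rightarrow> 'a set \<Rightarrow> nat" where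
  "cross_inversions B C = card {(x, y) \<in> B \<times> C. y < x}"

lemma maj_Nil [simp]: "maj [] = 0"
  and maj_singleton [simp]: "maj [x] = 0"
  by (simp_all add: maj_def)

lemma maj_snoc:
  assumes "w \<noteq> []"
  shows "maj (w @ [y]) = maj w + (if y < last w then length w else 0)"
proof -
  let ?D = "\<lambda>v. {i. Suc i < length v \<and> v ! Suc i < v ! i}"
  have fin: "finite (?D w)"
    by (rule finite_subset[of _ "{..<length w}"]) auto
  have "?D (w @ [y]) = ?D w \<union> (if y < last w then {length w - 1} else {})"
    (is "?L = ?R")
  proof (rule set_eqI)
    fix i show "i \<in> ?L \<longleftrightarrow> i \<in> ?R"
    proof (cases "Suc i = length w")
      case True
      then have "i = length w - 1" by simp
      with True assms show ?thesis by (auto simp: nth_append last_conv_nth)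
    next
      case False
      with assms show ?thesis by (auto simp: nth_append)
    qed
  qed
  moreover have "length w - 1 \<notin> ?D w" by auto
  ultimately show ?thesis
    using fin assms by (simp add: maj_def)
qed

lemma inversions_Nil [simp]: "inversions [] = 0"
  by (simp add: inversions_def)

lemma inversions_Cons:
  "inversions (x # w) = length (filter (\<lambda>y. y < x) w) + inversions w"
proof -
  let ?I = "{(i, j). i < j \<and> j < length w \<and> w ! j < w ! i}"
  have fin: "finite ?I"
    by (rule finite_subset[of _ "{..<length w} \<times> {..<length w}"]) auto
  have "{(i, j). i < j \<and> j < length (x # w) \<and> (x # w) ! j < (x # w) ! i} =
    (\<lambda>j. (0, Suc j)) ` {j. j < length w \<and> w ! j < x} \<union> map_prod Suc Suc ` ?I"
    (is "?L = ?R")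
  proof (rule set_eqI)
    fix p show "p \<in> ?L \<longleftrightarrow> p \<in> ?R"
      by (cases p; cases "fst p"; cases "snd p") auto
  qed
  moreover have "card ((\<lambda>j. (0::nat, Suc j)) ` {j. j < length w \<and> w ! j < x} \<union> map_prod Suc Suc ` ?I)
     = card {j. j < length w \<and> w ! j < x} + card ?I"
    by (subst card_Un_disjoint) (use fin in \<open>auto simp: card_image inj_on_def\<close>)
  ultimately show ?thesis
    by (simp add: inversions_def length_filter_conv_card)
qed

lemma cross_inversions_insert_left:
  assumes "finite B" "finite C" "x \<notin> B"
  shows "cross_inversions (insert x B) C = card {y \<in> C. y < x} + cross_inversions B C"
proof -
  have "{(a, y) \<in> insert x B \<times> C. y < a} = Pair x ` {y \<in> C. y < x} \<union> {(a, y) \<in> B \<times> C. y < a}"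
    by auto
  moreover have "finite {(a, y) \<in> B \<times> C. y < a}"
    by (rule finite_subset[of _ "B \<times> C"]) (use assms in auto)
  ultimately show ?thesis
    using assms unfolding cross_inversions_def
    by (simp add: card_Un_disjoint card_image inj_on_def disjoint_iff image_iff)
qed

lemma cross_inversions_insert_right:
  assumes "finite B" "finite C" "y \<notin> C"
  shows "cross_inversions B (insert y C) = card {x \<in> B. y < x} + cross_inversions B C"
proof -
  have "{(a, z) \<in> B \<times> insert y C. z < a} = (\<lambda>x. (x, y)) ` {x \<in> B. y < x} \<union> {(a, z) \<in> B \<times> C. z < a}"
    by auto
  moreover have "finite {(a, z) \<in> B \<times> C. z < a}"
    by (rule finite_subset[of _ "B \<times> C"]) (use assms in auto)
  ultimately show ?thesis
    using assms unfolding cross_inversions_def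
    by (simp add: card_Un_disjoint card_image inj_on_def disjoint_iff image_iff)
qed

lemma inversions_append:
  assumes "distinct (u @ v)"
  shows "inversions (u @ v) = inversions u + inversions v + cross_inversions (set u) (set v)"
  using assms
proof (induction u)
  case Nil
  then show ?case by (simp add: cross_inversions_def)
next
  case (Cons x u)
  have "length (filter (\<lambda>y. y < x) v) = card {y \<in> set v. y < x}"
    using Cons.prems by (metis distinct_append distinct_card distinct_filter set_filter)
  with Cons show ?case
    by (simp add: inversions_Cons cross_inversions_insert_left)
qed

lemma inversions_sorted: "sorted w \<Longrightarrow> inversions w = 0"
  by (induction w) (auto simp: inversions_Cons filter_empty_conv)

text \<open>A cut at \<open>m\<close> is weighted like a descent there. If \<open>y\<close> is
  smaller than the last letter \<open>x\<close>, only the cut at the end leaves a sorted suffix, and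
  its term is already the right-hand side. Otherwise the earlier cuts are those of the word without
  \<open>x\<close>, with \<open>x\<close> in the role of \<open>y\<close>, and each gains the factor
  1 - t^n for the new length n. By induction they add up to t^M (1 - t^n), where M is the major
  index of the word ending in \<open>x\<close>, and the cut at the end adds the missing t^(M +
  n).\<close>

lemma sum_sorted_suffixes:
  fixes t :: "'r::comm_ring_1"
  shows "(\<Sum>m | m \<le> length w \<and> sorted (drop m (w @ [y])).
            t ^ (maj (take m w) + m) * (\<Prod>j=Suc m..length w. 1 - t ^ j)) = t ^ maj (w @ [y])"
proof (induction w arbitrary: y rule: rev_induct)
  case Nil
  have "{m. m = 0 \<and> sorted (drop m [y])} = {0}" by auto
  then show ?case by simp
next
  case (snoc x w)
  let ?f = "\<lambda>w m. t ^ (maj (take m w) + m) * (\<Prod>j=Suc m..length w. 1 - t ^ j)"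
  let ?v = "w @ [x]"
  let ?n = "length ?v"
  show ?case
  proof (cases "y < x")
    case True
    have "{m. m \<le> ?n \<and> sorted (drop m (?v @ [y]))} = {?n}"
    proof (intro equalityI subsetI)
      fix m assume m: "m \<in> {m. m \<le> ?n \<and> sorted (drop m (?v @ [y]))}"
      have "m = ?n"
      proof (rule ccontr)
        assume "m \<noteq> ?n"
        then have "drop m (?v @ [y]) = drop m w @ [x, y]" using m by auto
        with m True show False by (auto simp: sorted_append)
      qed
      then show "m \<in> {?n}" by simp
    qed auto
    then show ?thesis using True by (simp add: maj_snoc[of "w @ [x]", simplified])
  next
    case False
    let ?S = "{m. m \<le> length w \<and> sorted (drop m (w @ [x]))}"
    have fin: "finite ?S" by (rule finite_subset[of _ "{..length w}"]) auto
    have "{m. m \<le> ?n \<and> sorted (drop m (?v @ [y]))} = insert ?n ?S"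
    proof (intro equalityI subsetI)
      fix m assume m: "m \<in> {m. m \<le> ?n \<and> sorted (drop m (?v @ [y]))}"
      show "m \<in> insert ?n ?S"
        using m by (cases "m = ?n") (auto simp: sorted_append)
    next
      fix m assume "m \<in> insert ?n ?S"
      then show "m \<in> {m. m \<le> ?n \<and> sorted (drop m (?v @ [y]))}"
        using False by (fastforce simp: sorted_append not_less)
    qed
    then have "(\<Sum>m | m \<le> ?n \<and> sorted (drop m (?v @ [y])). ?f ?v m)
       = ?f ?v ?n + (\<Sum>m\<in>?S. ?f ?v m)"
      using fin by (subst sum.insert[symmetric]) auto
    also have "(\<Sum>m\<in>?S. ?f ?v m) = (\<Sum>m\<in>?S. ?f w m) * (1 - t ^ ?n)"
      unfolding sum_distrib_right
      by (rule sum.cong) (auto simp: mult.assoc prod.nat_ivl_Suc')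
    also have "(\<Sum>m\<in>?S. ?f w m) = t ^ maj ?v" by (rule snoc)
    finally show ?thesis
      using False by (simp add: maj_snoc[of "w @ [x]", simplified] algebra_simps power_add)
  qed
qed

text \<open>The joint distribution of inversions and major index on the arrangements of
  \<open>T\<close>. Divided by the product of 1 - t^j for 1 \<le> j \<le> \<open>card T\<close>,
  with \<open>q\<close> the size of the field, it becomes the series of flags inside an isotropic
  space of dimension \<open>card T\<close>.\<close>

definition word_poly :: "'r::comm_ring_1 \<Rightarrow> 'r \<Rightarrow> 'a::linorder set \<Rightarrow> 'r" where
  "word_poly q t T = (\<Sum>w\<in>permutations_of_set T. q ^ inversions w * t ^ maj w)"

text \<open>Once the power of \<open>t\<close> is expanded over the cuts, a word with a cut amounts
  to a set \<open>B\<close> with an arrangement of it: behind the cut stands the increasing list of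
  \<open>T - B\<close>, admissible exactly if it stays below the wall \<open>y\<close>. That list
  has no inversions of its own, so only cross inversions are added.\<close>

lemma word_poly_wall:
  fixes q t :: "'r::comm_ring_1" and T :: "'a::linorder set"
  assumes "finite T" "y \<notin> T"
  shows "(\<Sum>w\<in>permutations_of_set T. q ^ inversions w * t ^ maj (w @ [y])) =
    (\<Sum>B | B \<subseteq> T \<and> T - B \<subseteq> {..<y}. q ^ cross_inversions B (T - B) * t ^ card B *
        word_poly q t B * (\<Prod>j=Suc (card B)..card T. 1 - t ^ j))"
proof -
  let ?W = "\<lambda>w. {m. m \<le> length w \<and> sorted (drop m (w @ [y]))}"
  let ?\<B> = "{B. B \<subseteq> T \<and> T - B \<subseteq> {..<y}}"
  let ?P = "\<lambda>m. \<Prod>j=Suc m..card T. 1 - t ^ j"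
  have fin\<B>: "finite ?\<B>" by (rule finite_subset[of _ "Pow T"]) (use assms in auto)
  have "(\<Sum>w\<in>permutations_of_set T. q ^ inversions w * t ^ maj (w @ [y])) =
     (\<Sum>w\<in>permutations_of_set T. \<Sum>m\<in>?W w. q ^ inversions w * (t ^ (maj (take m w) + m) * ?P m))"
    by (rule sum.cong)
       (auto simp flip: sum_distrib_left simp: sum_sorted_suffixes[symmetric] length_finite_permutations_of_set)
  also have "\<dots> = (\<Sum>(w, m)\<in>(SIGMA w:permutations_of_set T. ?W w). 
       q ^ inversions w * (t ^ (maj (take m w) + m) * ?P m))"
    by (rule sum.Sigma) (use assms in \<open>auto intro: finite_subset[of _ "{..length _}"]\<close>)
  also have "\<dots> = (\<Sum>(B, u)\<in>(SIGMA B:?\<B>. permutations_of_set B).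
       q ^ cross_inversions B (T - B) * t ^ card B * (q ^ inversions u * t ^ maj u) * ?P (card B))"
  proof (rule sum.reindex_bij_witness[where
        j = "\<lambda>(w, m). (set (take m w), take m w)" and
        i = "\<lambda>(B, u). (u @ sorted_list_of_set (T - B), length u)"])
    fix p assume "p \<in> (SIGMA w:permutations_of_set T. ?W w)"
    then obtain w m where p: "p = (w, m)" and w: "set w = T" "distinct w"
      and m: "m \<le> length w" "sorted (drop m (w @ [y]))"
      by (auto simp: permutations_of_set_def)
    have wd: "w = take m w @ drop m w" by simp
    have disj: "set (take m w) \<inter> set (drop m w) = {}" "distinct (drop m w)"
      using w(2) by (auto simp: set_take_disj_set_drop_if_distinct)
    have eq: "T - set (take m w) = set (drop m w)"
      using disj w wd by (metis Diff_cancel Un_Diff Un_Diff_Int Un_empty_right inf_commute set_append sup_bot.left_neutral)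
    have srt: "sorted (drop m w)" and low: "\<forall>x\<in>set (drop m w). x \<le> y"
      using m by (auto simp: sorted_append)
    \<comment> \<open>Sortedness gives only a weak inequality; it is strict because the wall is not
      a letter.\<close>
    have low': "set (drop m w) \<subseteq> {..<y}"
      using low w assms by (metis in_set_dropD lessThan_iff order_less_le subsetI)
    have sl: "sorted_list_of_set (T - set (take m w)) = drop m w"
      unfolding eq using srt disj by (simp add: sorted_list_of_set.idem_if_sorted_distinct)
    show "(case (case p of (w, m) \<Rightarrow> (set (take m w), take m w)) of
             (B, u) \<Rightarrow> (u @ sorted_list_of_set (T - B), length u)) = p"
      using m by (simp add: p sl)
    have sub: "set (take m w) \<subseteq> T" using w by (auto dest: in_set_takeD)
    show "(case p of (w, m) \<Rightarrow> (set (take m w), take m w)) \<in> (SIGMA B:?\<B>. permutations_of_set B)"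
      using w sub low' by (simp add: p eq permutations_of_set_def)
    have inv: "inversions w = inversions (take m w) + cross_inversions (set (take m w)) (T - set (take m w))"
      using inversions_append[of "take m w" "drop m w"] w srt by (simp add: eq inversions_sorted)
    have card: "card (set (take m w)) = m" using w m by (simp add: distinct_card)
    show "(case case p of (w, m) \<Rightarrow> (set (take m w), take m w) of (B, u) \<Rightarrow>
       q ^ cross_inversions B (T - B) * t ^ card B * (q ^ inversions u * t ^ maj u) * ?P (card B)) =
       (case p of (w, m) \<Rightarrow> q ^ inversions w * (t ^ (maj (take m w) + m) * ?P m))"
      by (simp add: p inv card power_add mult_ac)
  next
    fix p assume "p \<in> (SIGMA B:?\<B>. permutations_of_set B)"
    then obtain B u where p: "p = (B, u)" and B: "B \<subseteq> T" "T - B \<subseteq> {..<y}" 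
      and u: "set u = B" "distinct u"
      by (auto simp: permutations_of_set_def)
    have fin: "finite (T - B)" using assms by auto
    show "(case (case p of (B, u) \<Rightarrow> (u @ sorted_list_of_set (T - B), length u)) of
       (w, m) \<Rightarrow> (set (take m w), take m w)) = p"
      using u by (simp add: p)
    show "(case p of (B, u) \<Rightarrow> (u @ sorted_list_of_set (T - B), length u)) \<in> (SIGMA w:permutations_of_set T. ?W w)"
      using B u fin by (auto simp: p permutations_of_set_def sorted_append less_imp_le)
  qed
  also have "\<dots> = (\<Sum>B\<in>?\<B>. \<Sum>u\<in>permutations_of_set B.
       q ^ cross_inversions B (T - B) * t ^ card B * (q ^ inversions u * t ^ maj u) * ?P (card B))"
    by (rule sum.Sigma[symmetric]) (use fin\<B> assms in \<open>auto intro: finite_subset\<close>)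
  also have "\<dots> = (\<Sum>B\<in>?\<B>. q ^ cross_inversions B (T - B) * t ^ card B * word_poly q t B * ?P (card B))"
    by (simp add: word_poly_def sum_distrib_left sum_distrib_right)
  finally show ?thesis .
qed

section \<open>Gaussian binomials\<close>

text \<open>The factor for \<open>i = 0\<close> is split off, and each remaining factor releases one
  \<open>q\<close>. The case \<open>n = m\<close> treats the product of ordered bases, other
  \<open>n\<close> the right-hand side of the q-Pascal step.\<close>

lemma prod_power_diff_Suc:
  fixes q :: "'r::comm_ring_1"
  shows "(\<Prod>i<Suc m. q ^ Suc n - q ^ i) = (q ^ Suc n - 1) * q ^ m * (\<Prod>i<m. q ^ n - q ^ i)"
proof -
  have "(\<Prod>i<m. q ^ Suc n - q ^ Suc i) = (\<Prod>i<m. q * (q ^ n - q ^ i))"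
    by (simp add: algebra_simps)
  also have "\<dots> = q ^ m * (\<Prod>i<m. q ^ n - q ^ i)"
    by (simp add: prod.distrib)
  finally show ?thesis
    unfolding prod.lessThan_Suc_shift by (simp add: mult.assoc)
qed

text \<open>The q-Pascal rule for the largest letter \<open>b\<close>: in the complement it creates
  no inversion, in \<open>B\<close> it exceeds every letter of the complement. Multiplying by the
  product instead of dividing makes sense in every commutative ring and covers all \<open>m\<close>:
  for \<open>m > card T\<close> the sum is empty and the factor with \<open>i = card T\<close> on
  the right is zero.\<close>

lemma sum_subsets_cross_inversions:
  fixes q :: "'r::comm_ring_1" and T :: "'a::linorder set"
  assumes "finite T"
  shows "(\<Sum>B | B \<subseteq> T \<and> card B = m. q ^ cross_inversions B (T - B)) * (\<Prod>i<m. q ^ m - q ^ i)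
       = (\<Prod>i<m. q ^ card T - q ^ i)"
  using assms
proof (induction T arbitrary: m rule: finite_linorder_max_induct)
  case empty
  show ?case
  proof (cases m)
    case 0
    have "{B. B = ({}::'a set) \<and> card B = 0} = {{}}" by auto
    with 0 show ?thesis by (simp add: cross_inversions_def)
  next
    case (Suc k)
    have "{B. B \<subseteq> ({}::'a set) \<and> card B = Suc k} = {}" by auto
    moreover have "(\<Prod>i<Suc k. q ^ card ({}::'a set) - q ^ i) = 0"
      unfolding prod.lessThan_Suc_shift by simp
    ultimately show ?thesis unfolding Suc by (simp only: sum.empty mult_zero_left)
  qed
next
  case (insert b A)
  let ?S = "\<lambda>m. {B. B \<subseteq> A \<and> card B = m}"
  let ?P = "\<lambda>T m. \<Sum>B | B \<subseteq> T \<and> card B = m. q ^ cross_inversions B (T - B)"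
  have b: "b \<notin> A" using insert by auto
  have fS: "finite (?S m)" for m
    by (rule finite_subset[of _ "Pow A"]) (use insert in auto)
  have fB: "finite B" if "B \<subseteq> A" for B using that insert finite_subset by blast
  show ?case
  proof (cases m)
    case 0
    have "{B. B \<subseteq> insert b A \<and> card B = 0} = {{}}"
      using insert.hyps by (auto simp: card_eq_0_iff dest: finite_subset)
    with 0 show ?thesis by (simp add: cross_inversions_def)
  next
    case (Suc k)
    have split: "{B. B \<subseteq> insert b A \<and> card B = Suc k} = ?S (Suc k) \<union> insert b ` ?S k" (is "?L = ?R")
    proof (intro equalityI subsetI)
      fix B assume B: "B \<in> ?L"
      show "B \<in> ?R"
      proof (cases "b \<in> B")
        case True
        then have "B = insert b (B - {b})" "B - {b} \<in> ?S k" using B by auto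
        then show ?thesis by blast
      qed (use B in auto)
    next
      fix B assume "B \<in> ?R"
      then show "B \<in> ?L" using b fB by (auto simp: card_insert_if)
    qed
    have "?P (insert b A) (Suc k) = (\<Sum>B\<in>?S (Suc k). q ^ cross_inversions B (insert b A - B))
       + (\<Sum>B\<in>insert b ` ?S k. q ^ cross_inversions B (insert b A - B))"
      unfolding split by (rule sum.union_disjoint) (use fS b in auto)
    also have "(\<Sum>B\<in>?S (Suc k). q ^ cross_inversions B (insert b A - B)) = ?P A (Suc k)"
    proof (rule sum.cong)
      fix B assume B: "B \<in> ?S (Suc k)"
      have "insert b A - B = insert b (A - B)" using B b by auto
      moreover have no: "{x \<in> B. b < x} = {}" using B insert.hyps by force
      have "cross_inversions B (insert b (A - B)) = card {x \<in> B. b < x} + cross_inversions B (A - B)"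
        using B b fB insert.hyps by (intro cross_inversions_insert_right) auto
      ultimately show "q ^ cross_inversions B (insert b A - B) = q ^ cross_inversions B (A - B)"
        unfolding no by simp
    qed simp
    also have "(\<Sum>B\<in>insert b ` ?S k. q ^ cross_inversions B (insert b A - B)) = 
       (\<Sum>B\<in>?S k. q ^ cross_inversions (insert b B) (insert b A - insert b B))"
      by (rule sum.reindex_cong[of "insert b"]) (use b in \<open>auto intro!: inj_onI\<close>)
    also have "\<dots> = (\<Sum>B\<in>?S k. q ^ (card A - k) * q ^ cross_inversions B (A - B))"
    proof (rule sum.cong)
      fix B assume B: "B \<in> ?S k"
      have "insert b A - insert b B = A - B" using B b by auto
      moreover have "{y \<in> A - B. y < b} = A - B" using insert.hyps by auto
      moreover have "card (A - B) = card A - k" using B fB insert.hyps by (simp add: card_Diff_subset)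
      moreover have "cross_inversions (insert b B) (A - B) =
          card {y \<in> A - B. y < b} + cross_inversions B (A - B)"
        using B b fB insert.hyps by (intro cross_inversions_insert_left) auto
      ultimately show "q ^ cross_inversions (insert b B) (insert b A - insert b B) =
          q ^ (card A - k) * q ^ cross_inversions B (A - B)"
        by (simp only: power_add)
    qed simp
    finally have rec: "?P (insert b A) (Suc k) = ?P A (Suc k) + q ^ (card A - k) * ?P A k"
      by (simp add: sum_distrib_left)
    have IH: "?P A k * (\<Prod>i<k. q ^ k - q ^ i) = (\<Prod>i<k. q ^ card A - q ^ i)"
      "?P A (Suc k) * (\<Prod>i<Suc k. q ^ Suc k - q ^ i) = (\<Prod>i<Suc k. q ^ card A - q ^ i)"
      by (rule insert.IH)+
    have ci: "card (insert b A) = Suc (card A)" using b insert.hyps by simp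
    show ?thesis
    proof (cases "k \<le> card A")
      case True
      \<comment> \<open>The \<open>q ^ k\<close> released by the enlarged left product completes
        \<open>q ^ (card A - k)\<close> to a power that no longer depends on
        \<open>k\<close>.\<close>
      then have pw: "q ^ (card A - k) * q ^ k = q ^ card A" by (simp flip: power_add)
      let ?E = "\<Prod>i<k. q ^ card A - q ^ i"
      have "?P (insert b A) m * (\<Prod>i<m. q ^ m - q ^ i) =
        ?P A (Suc k) * (\<Prod>i<Suc k. q ^ Suc k - q ^ i) +
        (q ^ (card A - k) * q ^ k) * (q ^ Suc k - 1) * (?P A k * (\<Prod>i<k. q ^ k - q ^ i))"
        unfolding Suc rec by (simp add: algebra_simps prod_power_diff_Suc del: power_Suc prod.lessThan_Suc)
      also have "\<dots> = ?E * (q ^ card A - q ^ k) + q ^ card A * (q ^ Suc k - 1) * ?E"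
        unfolding IH pw by simp
      also have "\<dots> = (q ^ Suc (card A) - 1) * q ^ k * ?E"
        by (simp add: algebra_simps)
      finally show ?thesis unfolding Suc ci prod_power_diff_Suc .
    next
      case False
      have "?S j = {}" if "card A < j" for j
        using that by (auto dest!: card_mono[OF insert.hyps(1)])
      then have "?S k = {}" "?S (Suc k) = {}" using False by simp_all
      then have "?P (insert b A) m = 0" unfolding Suc rec by (simp only: sum.empty mult_zero_right add_0)
      moreover have "(\<Prod>i<m. q ^ card (insert b A) - q ^ i) = 0"
        using False by (intro prod_zero) (auto simp: Suc ci intro!: bexI[of _ "Suc (card A)"])
      ultimately show ?thesis by simp
    qed
  qed
qed

section \<open>Transversals of signed letters\<close>

definition signed_letters :: "nat \<Rightarrow> int set" where
  "signed_letters d = {i. i \<noteq> 0 \<and> \<bar>i\<bar> \<le> int d}"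

text \<open>The possible letter sets of the value lists \<sigma>(1), ..., \<sigma>(d) of signed
  permutations: one letter from each pair \<open>v\<close>, \<open>- v\<close>.\<close>

definition transversals :: "nat \<Rightarrow> int set set" where
  "transversals d = {T. T \<subseteq> signed_letters d \<and> (\<forall>v\<in>signed_letters d. (v \<in> T) \<noteq> (- v \<in> T))}"

text \<open>It is applied to flipped letters, where \<open>x > 0\<close> stands for the negative
  value \<open>x - (d + 1)\<close>. So \<open>nat x\<close> is the summand of that value in the
  second part of \<open>signed_length\<close>, and also its distance from the wall at 0.\<close>

definition positive_sum :: "int set \<Rightarrow> nat" where
  "positive_sum T = (\<Sum>x | x \<in> T \<and> 0 < x. nat x)"

text \<open>\<open>B\<close> is the part of the letters before a cut and \<open>C\<close> the sorted
  part behind it. Since \<open>C\<close> must lie below the wall 0, all positive letters are in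
  \<open>B\<close>.\<close>

definition split_transversals :: "nat \<Rightarrow> nat \<Rightarrow> (int set \<times> int set) set" where
  "split_transversals d m =
    {(B, C). B \<inter> C = {} \<and> C \<subseteq> {..<0} \<and> B \<union> C \<in> transversals d \<and> card B = m}"

lemma finite_signed_letters [simp]: "finite (signed_letters d)"
  by (rule finite_subset[of _ "{- int d..int d}"]) (auto simp: signed_letters_def)

lemma finite_transversals [simp]: "finite (transversals d)"
  by (rule finite_subset[of _ "Pow (signed_letters d)"]) (auto simp: transversals_def)

lemma finite_transversal: "T \<in> transversals d \<Longrightarrow> finite T"
  using finite_subset[OF _ finite_signed_letters] by (auto simp: transversals_def)

lemma finite_split_transversals [simp]: "finite (split_transversals d m)"
  by (rule finite_subset[of _ "Pow (signed_letters d) \<times> Pow (signed_letters d)"])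
     (auto simp: split_transversals_def transversals_def)

lemma signed_letters_Suc:
  "signed_letters (Suc d) = {int (Suc d), - int (Suc d)} \<union> signed_letters d"
  by (auto simp: signed_letters_def)

lemma signed_letters_bounds: "x \<in> signed_letters d \<Longrightarrow> x < int (Suc d) \<and> - int (Suc d) < x"
  by (auto simp: signed_letters_def)

lemma transversal_insert:
  assumes "T \<in> transversals d" "\<bar>x\<bar> = int (Suc d)"
  shows "insert x T \<in> transversals (Suc d)"
proof -
  have T: "T \<subseteq> signed_letters d" "\<And>v. v \<in> signed_letters d \<Longrightarrow> (v \<in> T) \<noteq> (- v \<in> T)"
    using assms by (auto simp: transversals_def)
  have "int (Suc d) \<notin> signed_letters d" "- int (Suc d) \<notin> signed_letters d"
    by (auto simp: signed_letters_def)
  then have n: "int (Suc d) \<notin> T" "- int (Suc d) \<notin> T" using T by auto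
  have x: "x = int (Suc d) \<or> x = - int (Suc d)" using assms by linarith
  have "(v \<in> insert x T) \<noteq> (- v \<in> insert x T)" if v: "v \<in> signed_letters (Suc d)" for v
  proof (cases "v \<in> signed_letters d")
    case True
    then show ?thesis using T(2)[OF True] x signed_letters_bounds[OF True] by auto
  next
    case False
    then have "v = int (Suc d) \<or> v = - int (Suc d)" using v by (auto simp: signed_letters_Suc)
    then show ?thesis using x n by (auto simp: add.commute)
  qed
  moreover have "insert x T \<subseteq> signed_letters (Suc d)"
    using T(1) x unfolding signed_letters_Suc by blast
  ultimately show ?thesis unfolding transversals_def by blast
qed

lemma transversal_remove:
  assumes "T \<in> transversals (Suc d)" "x \<in> T" "\<bar>x\<bar> = int (Suc d)"
  shows "T - {x} \<in> transversals d"
proof -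
  have T: "T \<subseteq> signed_letters (Suc d)" "\<And>v. v \<in> signed_letters (Suc d) \<Longrightarrow> (v \<in> T) \<noteq> (- v \<in> T)"
    using assms by (auto simp: transversals_def)
  have x: "x = int (Suc d) \<or> x = - int (Suc d)" using assms by linarith
  have "- x \<notin> T" using T assms by auto
  then have "T - {x} \<subseteq> signed_letters d"
    using T(1) x unfolding signed_letters_Suc by (auto simp del: of_nat_Suc)
  moreover have "(v \<in> T - {x}) \<noteq> (- v \<in> T - {x})" if "v \<in> signed_letters d" for v
    using that T(2)[of v] x signed_letters_bounds[OF that] by (auto simp: signed_letters_Suc)
  ultimately show ?thesis unfolding transversals_def by blast
qed

lemma card_transversal: "T \<in> transversals d \<Longrightarrow> card T = d"
proof (induction d arbitrary: T)
  case 0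
  then show ?case by (auto simp: transversals_def signed_letters_def)
next
  case (Suc d)
  have "int (Suc d) \<in> signed_letters (Suc d)" by (auto simp: signed_letters_def)
  then obtain x where x: "x \<in> T" "\<bar>x\<bar> = int (Suc d)"
    using Suc.prems unfolding transversals_def by force
  have "card (T - {x}) = d" using transversal_remove[OF Suc.prems x] Suc.IH by blast
  then show ?case using x finite_transversal[OF Suc.prems]
    by (metis card.remove)
qed

text \<open>Exactly one letter of the new pair occurs. The negative one may join either block, the
  positive one only \<open>B\<close>, because \<open>C\<close> stays below 0.\<close>

lemma split_transversals_Suc:
  "split_transversals (Suc d) m =
     (\<lambda>(B, C). (B, insert (- int (Suc d)) C)) ` split_transversals d m \<union>
     (if m = 0 then {} else
       (\<lambda>(B, C). (insert (- int (Suc d)) B, C)) ` split_transversals d (m - 1) \<union>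
       (\<lambda>(B, C). (insert (int (Suc d)) B, C)) ` split_transversals d (m - 1))"
  (is "?L = ?R")
proof (intro equalityI subsetI)
  fix p assume "p \<in> ?L"
  then obtain B C where p: "p = (B, C)" and BC: "B \<inter> C = {}" "C \<subseteq> {..<0}"
    "B \<union> C \<in> transversals (Suc d)" "card B = m"
    by (auto simp: split_transversals_def)
  have fB: "finite B" using finite_transversal[OF BC(3)] by simp
  have "int (Suc d) \<in> signed_letters (Suc d)" by (auto simp: signed_letters_def)
  then obtain x where x: "x \<in> B \<union> C" "\<bar>x\<bar> = int (Suc d)"
    using BC(3) unfolding transversals_def by force
  have rem: "(B \<union> C) - {x} \<in> transversals d" by (rule transversal_remove[OF BC(3) x])
  show "p \<in> ?R"
  proof (cases "x \<in> B")
    case True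
    then have m: "m \<noteq> 0" using BC fB by auto
    have "(B \<union> C) - {x} = (B - {x}) \<union> C" using True BC by auto
    then have "(B - {x}, C) \<in> split_transversals d (m - 1)"
      using rem BC True by (auto simp: split_transversals_def)
    moreover have "p = (insert x (B - {x}), C)" using True p by auto
    moreover have "x = int (Suc d) \<or> x = - int (Suc d)" using x by linarith
    ultimately have "p \<in> (\<lambda>(B, C). (insert (- int (Suc d)) B, C)) ` split_transversals d (m - 1) \<union>
       (\<lambda>(B, C). (insert (int (Suc d)) B, C)) ` split_transversals d (m - 1)"
      unfolding Un_iff image_iff by (metis case_prod_conv)
    then show ?thesis unfolding if_not_P[OF m] by (rule UnI2)
  next
    case False
    then have xC: "x \<in> C" using x by auto
    then have "x < 0" using BC by auto
    then have xs: "x = - int (Suc d)" using x by linarith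
    have "(B \<union> C) - {x} = B \<union> (C - {x})" using False by auto
    then have "(B, C - {x}) \<in> split_transversals d m"
      using rem BC by (auto simp: split_transversals_def)
    moreover have "p = (B, insert x (C - {x}))" using xC p by auto
    ultimately have "p \<in> (\<lambda>(B, C). (B, insert (- int (Suc d)) C)) ` split_transversals d m"
      unfolding xs by (intro image_eqI) simp_all
    then show ?thesis by (rule UnI1)
  qed
next
  have nin: "x \<notin> T" if "T \<in> transversals d" "\<bar>x\<bar> = int (Suc d)" for x T
  proof
    assume "x \<in> T"
    then have "x \<in> signed_letters d" using that(1) unfolding transversals_def by blast
    then show False using that(2) by (simp add: signed_letters_def)
  qed
  fix p assume "p \<in> ?R"
  then have "p \<in> (\<lambda>(B, C). (B, insert (- int (Suc d)) C)) ` split_transversals d m \<or>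
    (m \<noteq> 0 \<and> (\<exists>x. \<bar>x\<bar> = int (Suc d) \<and> p \<in> (\<lambda>(B, C). (insert x B, C)) ` split_transversals d (m - 1)))"
  proof (cases "m = 0")
    case False
    moreover have "\<bar>- int (Suc d)\<bar> = int (Suc d)" "\<bar>int (Suc d)\<bar> = int (Suc d)" by auto
    moreover have "p \<in> (\<lambda>(B, C). (B, insert (- int (Suc d)) C)) ` split_transversals d m \<or>
        p \<in> (\<lambda>(B, C). (insert (- int (Suc d)) B, C)) ` split_transversals d (m - 1) \<or>
        p \<in> (\<lambda>(B, C). (insert (int (Suc d)) B, C)) ` split_transversals d (m - 1)"
      using \<open>p \<in> ?R\<close> unfolding if_not_P[OF False] Un_iff .
    ultimately show ?thesis using False by blast
  qed simp
  then show "p \<in> ?L"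
  proof (elim disjE conjE exE)
    assume "p \<in> (\<lambda>(B, C). (B, insert (- int (Suc d)) C)) ` split_transversals d m"
    then obtain B C where p: "p = (B, insert (- int (Suc d)) C)" and BC: "(B, C) \<in> split_transversals d m"
      by (auto simp del: of_nat_Suc)
    then show ?thesis
      using nin[of "B \<union> C" "- int (Suc d)"] transversal_insert[of "B \<union> C" d "- int (Suc d)"]
      by (auto simp: split_transversals_def)
  next
    fix x assume m: "m \<noteq> 0" and x: "\<bar>x\<bar> = int (Suc d)"
      and "p \<in> (\<lambda>(B, C). (insert x B, C)) ` split_transversals d (m - 1)"
    then obtain B C where p: "p = (insert x B, C)" and "(B, C) \<in> split_transversals d (m - 1)"
      by (auto simp del: of_nat_Suc)
    then have BC: "B \<inter> C = {}" "C \<subseteq> {..<0}" "B \<union> C \<in> transversals d" "card B = m - 1"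
      by (simp_all add: split_transversals_def)
    have "finite B" using finite_transversal[OF BC(3)] by simp
    then show ?thesis
      using nin[OF BC(3) x] transversal_insert[OF BC(3) x] BC m
      by (simp add: split_transversals_def p)
  qed
qed

text \<open>The combinatorial counterpart of \<open>I\<^sub>m\<close>: with \<open>q\<close> the
  size of the field and \<open>m \<le> d\<close> it turns out to be the number of isotropic
  subspaces of dimension \<open>m\<close>.\<close>

definition split_poly :: "'r::comm_ring_1 \<Rightarrow> nat \<Rightarrow> nat \<Rightarrow> 'r" where
  "split_poly q d m = (\<Sum>(B, C)\<in>split_transversals d m. q ^ (cross_inversions B C + positive_sum B))"

lemma split_transversalsD:
  assumes "(B, C) \<in> split_transversals d m"
  shows "finite B" "finite C" "card B = m" "card C = d - m" "m \<le> d" "B \<inter> C = {}"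
    "B \<subseteq> signed_letters d" "C \<subseteq> signed_letters d"
    "int (Suc d) \<notin> B" "- int (Suc d) \<notin> B" "int (Suc d) \<notin> C" "- int (Suc d) \<notin> C"
proof -
  have T: "B \<union> C \<in> transversals d" "B \<inter> C = {}" "card B = m"
    using assms by (auto simp: split_transversals_def)
  then show fin: "finite B" "finite C" using finite_transversal by blast+
  have "card B + card C = d"
    using card_transversal[OF T(1)] card_Un_disjoint[OF fin T(2)] by simp
  then show "card B = m" "card C = d - m" "m \<le> d" "B \<inter> C = {}" using T by auto
  show "B \<subseteq> signed_letters d" "C \<subseteq> signed_letters d"
    using T by (auto simp: transversals_def)
  then show "int (Suc d) \<notin> B" "- int (Suc d) \<notin> B" "int (Suc d) \<notin> C" "- int (Suc d) \<notin> C"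
    by (auto simp: signed_letters_def)
qed

lemma positive_sum_insert:
  assumes "finite B" "x \<notin> B"
  shows "positive_sum (insert x B) = nat x + positive_sum B"
proof (cases "0 < x")
  case True
  then have "{y. y \<in> insert x B \<and> 0 < y} = insert x {y. y \<in> B \<and> 0 < y}" by auto
  then show ?thesis using assms by (simp add: positive_sum_def)
next
  case False
  then have "{y. y \<in> insert x B \<and> 0 < y} = {y. y \<in> B \<and> 0 < y}" by auto
  then show ?thesis using False by (simp add: positive_sum_def)
qed

text \<open>The letter -(d+1) is below all others: in \<open>C\<close> it forms an inversion with
  each of the \<open>m\<close> letters of \<open>B\<close>, in \<open>B\<close> it adds nothing. The
  letter d+1 in \<open>B\<close> exceeds the d - (m - 1) letters of \<open>C\<close> and adds d + 1
  to \<open>positive_sum\<close>, together 2d + 2 - m.\<close>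

lemma split_poly_Suc:
  fixes q :: "'r::comm_ring_1"
  shows "split_poly q (Suc d) m = q ^ m * split_poly q d m +
    (if m = 0 then 0 else (1 + q ^ (2 * d + 2 - m)) * split_poly q d (m - 1))"
proof -
  let ?s = "int (Suc d)"
  let ?w = "\<lambda>(B, C). q ^ (cross_inversions B C + positive_sum B)"
  let ?f = "\<lambda>(B, C). (B, insert (- ?s) C)"
  let ?g = "\<lambda>x (B, C). (insert x B, C)"
  have injf: "inj_on ?f (split_transversals d m)"
  proof (rule inj_onI, clarify)
    fix B C B' C' assume "(B, C) \<in> split_transversals d m" "(B', C') \<in> split_transversals d m"
      "insert (- ?s) C = insert (- ?s) C'"
    then show "B = B \<and> C = C'"
      using insert_ident split_transversalsD(12) by metis
  qed
  have injg: "inj_on (?g x) (split_transversals d k)" if x: "x = ?s \<or> x = - ?s" for x k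
  proof (rule inj_onI, clarify)
    fix B C B' C' assume "(B, C) \<in> split_transversals d k" "(B', C') \<in> split_transversals d k"
      "insert x B = insert x B'"
    then show "B = B' \<and> C = C"
      using insert_ident split_transversalsD(9,10) x by metis
  qed
  have f: "(\<Sum>p\<in>?f ` split_transversals d m. ?w p) = q ^ m * split_poly q d m"
    unfolding sum.reindex[OF injf] split_poly_def sum_distrib_left
  proof (rule sum.cong)
    fix p assume p: "p \<in> split_transversals d m"
    obtain B C where BC: "p = (B, C)" by (cases p)
    note D = split_transversalsD[OF p[unfolded BC]]
    have "{x \<in> B. - ?s < x} = B" using D(7) signed_letters_bounds by blast
    then show "(?w \<circ> ?f) p = q ^ m * ?w p"
      using D by (simp add: BC cross_inversions_insert_right power_add mult_ac)
  qed simp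
  show ?thesis
  proof (cases "m = 0")
    case True
    then show ?thesis using f
      unfolding split_poly_def split_transversals_Suc by simp
  next
    case False
    let ?S = "split_transversals d (m - 1)"
    have g1: "(\<Sum>p\<in>?g (- ?s) ` ?S. ?w p) = split_poly q d (m - 1)"
      unfolding sum.reindex[OF injg, OF disjI2[OF refl]] split_poly_def
    proof (rule sum.cong)
      fix p assume p: "p \<in> ?S"
      obtain B C where BC: "p = (B, C)" by (cases p)
      note D = split_transversalsD[OF p[unfolded BC]]
      have no: "{y \<in> C. y < - ?s} = {}" using D(8) signed_letters_bounds by force
      have "cross_inversions (insert (- ?s) B) C = cross_inversions B C"
        unfolding cross_inversions_insert_left[OF D(1,2,10)] no by simp
      then show "(?w \<circ> ?g (- ?s)) p = ?w p"
        unfolding BC using positive_sum_insert[OF D(1,10)] by simp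
    qed simp
    have g2: "(\<Sum>p\<in>?g ?s ` ?S. ?w p) = q ^ (2 * d + 2 - m) * split_poly q d (m - 1)"
      unfolding sum.reindex[OF injg, OF disjI1[OF refl]] split_poly_def sum_distrib_left
    proof (rule sum.cong)
      fix p assume p: "p \<in> ?S"
      obtain B C where BC: "p = (B, C)" by (cases p)
      note D = split_transversalsD[OF p[unfolded BC]]
      have "{y \<in> C. y < ?s} = C" using D(8) signed_letters_bounds by blast
      then have eq: "cross_inversions (insert ?s B) C + positive_sum (insert ?s B) =
         (2 * d + 2 - m) + (cross_inversions B C + positive_sum B)"
        using D False by (simp add: cross_inversions_insert_left positive_sum_insert nat_add_distrib)
      show "(?w \<circ> ?g ?s) p = q ^ (2 * d + 2 - m) * ?w p"
        unfolding BC comp_def case_prod_conv eq by (rule power_add)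
    qed simp
    have "?s \<noteq> - ?s" by simp
    then have fstD: "?s \<notin> fst p \<and> - ?s \<notin> fst p" if "p \<in> ?f ` split_transversals d m" for p
      using that split_transversalsD(9,10) by (auto simp del: of_nat_Suc)
    have fst1: "- ?s \<in> fst p \<and> ?s \<notin> fst p" if "p \<in> ?g (- ?s) ` ?S" for p
      using that split_transversalsD(9) \<open>?s \<noteq> - ?s\<close> by (auto simp del: of_nat_Suc)
    have fst2: "?s \<in> fst p" if "p \<in> ?g ?s ` ?S" for p
      using that by (auto simp del: of_nat_Suc)
    have dis: "?f ` split_transversals d m \<inter> (?g (- ?s) ` ?S \<union> ?g ?s ` ?S) = {}"
      using fstD fst1 fst2 unfolding disjoint_iff Un_iff by metis
    have dis2: "?g (- ?s) ` ?S \<inter> ?g ?s ` ?S = {}"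
      using fst1 fst2 unfolding disjoint_iff by metis
    have "split_poly q (Suc d) m = (\<Sum>p\<in>?f ` split_transversals d m. ?w p) +
       ((\<Sum>p\<in>?g (- ?s) ` ?S. ?w p) + (\<Sum>p\<in>?g ?s ` ?S. ?w p))"
      unfolding split_poly_def split_transversals_Suc using False dis dis2
      by (simp add: sum.union_disjoint)
    then show ?thesis unfolding f g1 g2 using False by (simp add: algebra_simps)
  qed
qed

lemma split_poly_gt: "d < m \<Longrightarrow> split_poly q d m = 0"
  using split_transversalsD(5)[of _ _ d m] by (force simp: split_poly_def intro: sum.neutral)

text \<open>For a field of size \<open>q\<close> these products count ordered bases of isotropic
  subspaces: the next vector after \<open>i\<close> others avoids a span of size
  \<open>q ^ i\<close> inside a complement of size \<open>q ^ (2 * d - i)\<close>. The bound on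
  \<open>m\<close> keeps the subtraction in the exponent exact, so that raising \<open>d\<close> and
  \<open>i\<close> together multiplies each factor by \<open>q\<close>.\<close>

lemma prod_symplectic_diff_Suc:
  fixes q :: "'r::comm_ring_1"
  assumes "m \<le> d"
  shows "(\<Prod>i<Suc m. q ^ (2 * Suc d - i) - q ^ i) =
    (q ^ (2 * d + 2) - 1) * q ^ m * (\<Prod>i<m. q ^ (2 * d - i) - q ^ i)"
proof -
  have "(\<Prod>i<m. q ^ (2 * Suc d - Suc i) - q ^ Suc i) = (\<Prod>i<m. q * (q ^ (2 * d - i) - q ^ i))"
  proof (rule prod.cong)
    fix i assume "i \<in> {..<m}"
    then have "2 * Suc d - Suc i = Suc (2 * d - i)" using assms by auto
    then show "q ^ (2 * Suc d - Suc i) - q ^ Suc i = q * (q ^ (2 * d - i) - q ^ i)"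
      by (simp only: power_Suc right_diff_distrib)
  qed simp
  also have "\<dots> = q ^ m * (\<Prod>i<m. q ^ (2 * d - i) - q ^ i)"
    by (simp add: prod.distrib)
  finally show ?thesis
    unfolding prod.lessThan_Suc_shift by (simp add: mult.assoc)
qed

text \<open>The recursion over the pairs of letters agrees with the product formula as soon as both
  of its terms are multiplied by the product of ordered bases of the larger size.\<close>

lemma split_poly_eq:
  fixes q :: "'r::comm_ring_1"
  assumes "m \<le> d"
  shows "split_poly q d m * (\<Prod>i<m. q ^ m - q ^ i) = (\<Prod>i<m. q ^ (2 * d - i) - q ^ i)"
  using assms
proof (induction d arbitrary: m)
  case 0
  have "signed_letters 0 = {}" by (auto simp: signed_letters_def)
  then have "split_transversals 0 0 = {({}, {})}"
    by (auto simp: split_transversals_def transversals_def)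
  then show ?case using 0 by (simp add: split_poly_def cross_inversions_def positive_sum_def)
next
  case (Suc d)
  show ?case
  proof (cases m)
    case 0
    then show ?thesis using Suc.IH[of 0] by (simp add: split_poly_Suc)
  next
    case (Suc k)
    then have k: "k \<le> d" using Suc.prems by simp
    let ?K = "\<Prod>i<k. q ^ (2 * d - i) - q ^ i"
    have IH1: "split_poly q d k * (\<Prod>i<k. q ^ k - q ^ i) = ?K" by (rule Suc.IH[OF k])
    \<comment> \<open>For \<open>k = d\<close> the induction hypothesis does not reach
      \<open>Suc k\<close>, but both sides vanish: no \<open>B\<close> has more than
      \<open>d\<close> letters, and the last factor on the right is
      \<open>q ^ d - q ^ d\<close>.\<close>
    have IH2: "split_poly q d (Suc k) * (\<Prod>i<Suc k. q ^ Suc k - q ^ i) = ?K * (q ^ (2 * d - k) - q ^ k)"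
    proof (cases "k = d")
      case True
      then show ?thesis by (simp add: split_poly_gt)
    next
      case False
      then show ?thesis using Suc.IH[of "Suc k"] k by simp
    qed
    \<comment> \<open>The powers in \<open>p2\<close> and \<open>p3\<close> enter with opposite
      signs and cancel; the one in \<open>p1\<close> survives.\<close>
    have p1: "q ^ (2 * d + 2 - Suc k) * q ^ Suc k = q ^ (2 * d + 2)"
      and p2: "q ^ Suc k * q ^ (2 * d - k) = q ^ (2 * d + 1)"
      and p3: "q ^ (2 * d + 2 - Suc k) * q ^ k = q ^ (2 * d + 1)"
      unfolding power_add[symmetric] using k by (auto intro!: arg_cong[of _ _ "power q"] simp del: power_Suc)
    have "split_poly q (Suc d) m * (\<Prod>i<m. q ^ m - q ^ i) =
       q ^ Suc k * (split_poly q d (Suc k) * (\<Prod>i<Suc k. q ^ Suc k - q ^ i)) +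
       (1 + q ^ (2 * d + 2 - Suc k)) * (q ^ Suc k - 1) * q ^ k * (split_poly q d k * (\<Prod>i<k. q ^ k - q ^ i))"
      unfolding Suc split_poly_Suc[of q d "Suc k"]
      by (simp add: algebra_simps prod_power_diff_Suc del: power_Suc prod.lessThan_Suc)
    also have "\<dots> = ?K * (q ^ Suc k * q ^ (2 * d - k) - q ^ Suc k * q ^ k
         + q ^ k * q ^ Suc k - q ^ k + q ^ k * (q ^ (2 * d + 2 - Suc k) * q ^ Suc k) - q ^ (2 * d + 2 - Suc k) * q ^ k)"
      unfolding IH1 IH2 by (simp add: algebra_simps del: power_Suc)
    also have "\<dots> = (q ^ (2 * d + 2) - 1) * q ^ k * ?K"
      unfolding p1 p2 p3 by (simp add: algebra_simps)
    finally show ?thesis unfolding Suc prod_symplectic_diff_Suc[OF k] .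
  qed
qed

section \<open>Gaussian binomials by cardinality and the recursion for words\<close>

definition gaussian :: "'r::comm_ring_1 \<Rightarrow> nat \<Rightarrow> nat \<Rightarrow> 'r" where
  "gaussian q n m = (\<Sum>B | B \<subseteq> {..<n} \<and> card B = m. q ^ cross_inversions B ({..<n} - B))"

text \<open>Everything later about \<open>gaussian\<close> goes through this identity, which subset
  sums over any finite chain and the counts of subspaces satisfy as well.\<close>

lemma gaussian_eq:
  "gaussian q n m * (\<Prod>i<m. q ^ m - q ^ i) = (\<Prod>i<m. q ^ n - q ^ i)"
  using sum_subsets_cross_inversions[of "{..<n}" q m] by (simp add: gaussian_def)

lemma sum_subsets_by_card:
  assumes "finite T"
  shows "(\<Sum>B | B \<subseteq> T. f B) = (\<Sum>m\<le>card T. \<Sum>B | B \<subseteq> T \<and> card B = m. f B)"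
proof -
  have "(\<Sum>B | B \<subseteq> T. f B) = (\<Sum>m\<le>card T. \<Sum>B\<in>{B \<in> {B. B \<subseteq> T}. card B = m}. f B)"
    by (rule sum.group[symmetric]) (use assms card_mono in \<open>auto simp: Pow_def[symmetric]\<close>)
  then show ?thesis by simp
qed

text \<open>Each factor is \<open>q ^ i\<close> times \<open>q ^ (m - i) - 1\<close>, hence nonzero
  if \<open>q\<close> is no root of unity. Cancelling this product turns the multiplied identities
  into equalities of counts.\<close>

lemma prod_power_diff_nonzero:
  fixes q :: "'r::idom"
  assumes "q \<noteq> 0" "\<And>n. 0 < n \<Longrightarrow> q ^ n \<noteq> 1"
  shows "(\<Prod>i<m. q ^ m - q ^ i) \<noteq> 0"
proof -
  have "q ^ m - q ^ i \<noteq> 0" if "i < m" for i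
  proof -
    have "q ^ m - q ^ i = q ^ i * (q ^ (m - i) - 1)"
      using that by (simp add: right_diff_distrib flip: power_add)
    then show ?thesis using assms that by simp
  qed
  then show ?thesis by simp
qed

lemma sum_subsets_eq_gaussian:
  fixes q :: "'r::idom"
  assumes "q \<noteq> 0" "\<And>n. 0 < n \<Longrightarrow> q ^ n \<noteq> 1" "finite T"
  shows "(\<Sum>B | B \<subseteq> T \<and> card B = m. q ^ cross_inversions B (T - B)) = gaussian q (card T) m"
proof (rule mult_right_cancel[THEN iffD1])
  show "(\<Prod>i<m. q ^ m - q ^ i) \<noteq> 0" by (rule prod_power_diff_nonzero[OF assms(1,2)])
qed (simp only: sum_subsets_cross_inversions[OF assms(3)] gaussian_eq)

text \<open>A wall above every letter is never preceded by a descent and excludes no subset, so the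
  formula with a wall specialises to plain words.\<close>

lemma word_poly_recursion:
  fixes q t :: "'r::comm_ring_1" and T :: "int set"
  assumes "finite T"
  shows "word_poly q t T = (\<Sum>m\<le>card T. \<Sum>B | B \<subseteq> T \<and> card B = m.
     q ^ cross_inversions B (T - B) * t ^ m * word_poly q t B * (\<Prod>j=Suc m..card T. 1 - t ^ j))"
proof -
  \<comment> \<open>Inserting 0 gives \<open>Max\<close> a nonempty set even if \<open>T\<close> is
    empty.\<close>
  define y where "y = Max (insert 0 T) + 1"
  have y: "x < y" if "x \<in> T" for x
    using Max_ge[of "insert 0 T" x] that assms by (simp add: y_def)
  have "maj (w @ [y]) = maj w" if w: "w \<in> permutations_of_set T" for w
  proof (cases "w = []")
    case False
    then have "last w \<in> T" using w permutations_of_setD(1) last_in_set by blast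
    then show ?thesis using y[of "last w"] False by (simp add: maj_snoc)
  qed simp
  then have "word_poly q t T = (\<Sum>w\<in>permutations_of_set T. q ^ inversions w * t ^ maj (w @ [y]))"
    by (simp add: word_poly_def)
  also have "\<dots> = (\<Sum>B | B \<subseteq> T \<and> T - B \<subseteq> {..<y}. q ^ cross_inversions B (T - B) * t ^ card B *
        word_poly q t B * (\<Prod>j=Suc (card B)..card T. 1 - t ^ j))"
    using y by (intro word_poly_wall assms) auto
  also have "{B. B \<subseteq> T \<and> T - B \<subseteq> {..<y}} = {B. B \<subseteq> T}"
    using y by auto
  also have "(\<Sum>B | B \<subseteq> T. q ^ cross_inversions B (T - B) * t ^ card B *
        word_poly q t B * (\<Prod>j=Suc (card B)..card T. 1 - t ^ j)) =
    (\<Sum>m\<le>card T. \<Sum>B | B \<subseteq> T \<and> card B = m. q ^ cross_inversions B (T - B) * t ^ card B *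
        word_poly q t B * (\<Prod>j=Suc (card B)..card T. 1 - t ^ j))"
    by (rule sum_subsets_by_card[OF assms])
  finally show ?thesis by simp
qed

text \<open>The term \<open>m = card T\<close> is \<open>t ^ card T\<close> times the unknown and
  moves to the left. The function \<open>h\<close> is required only on proper subsets, which is what
  a strong induction on the size provides.\<close>

lemma word_poly_card_recursion:
  fixes q t :: "'r::idom" and T :: "int set"
  assumes q: "q \<noteq> 0" "\<And>n. 0 < n \<Longrightarrow> q ^ n \<noteq> 1" and "finite T"
    and h: "\<And>B. B \<subset> T \<Longrightarrow> word_poly q t B = h (card B)"
  shows "(1 - t ^ card T) * word_poly q t T =
    (\<Sum>m<card T. gaussian q (card T) m * t ^ m * h m * (\<Prod>j=Suc m..card T. 1 - t ^ j))"
proof -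
  let ?n = "card T"
  let ?f = "\<lambda>m. \<Sum>B | B \<subseteq> T \<and> card B = m.
     q ^ cross_inversions B (T - B) * t ^ m * word_poly q t B * (\<Prod>j=Suc m..?n. 1 - t ^ j)"
  have "word_poly q t T = (\<Sum>m\<le>?n. ?f m)" by (rule word_poly_recursion[OF assms(3)])
  also have "\<dots> = (\<Sum>m<?n. ?f m) + ?f ?n" by (simp add: lessThan_Suc_atMost[symmetric])
  also have "{B. B \<subseteq> T \<and> card B = ?n} = {T}"
    using card_subset_eq[OF assms(3)] by auto
  also have "(\<Sum>B\<in>{T}. q ^ cross_inversions B (T - B) * t ^ ?n * word_poly q t B * (\<Prod>j=Suc ?n..?n. 1 - t ^ j))
     = t ^ ?n * word_poly q t T"
    by (simp add: cross_inversions_def)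
  also have "(\<Sum>m<?n. ?f m) = (\<Sum>m<?n. gaussian q ?n m * t ^ m * h m * (\<Prod>j=Suc m..?n. 1 - t ^ j))"
  proof (rule sum.cong)
    fix m assume m: "m \<in> {..<?n}"
    have "?f m = (\<Sum>B | B \<subseteq> T \<and> card B = m. q ^ cross_inversions B (T - B) * (t ^ m * h m * (\<Prod>j=Suc m..?n. 1 - t ^ j)))"
      by (rule sum.cong) (use m h in \<open>auto simp: psubset_eq mult.assoc\<close>)
    then show "?f m = gaussian q ?n m * t ^ m * h m * (\<Prod>j=Suc m..?n. 1 - t ^ j)"
      by (simp add: sum_subsets_eq_gaussian[OF assms(1-3)] mult.assoc flip: sum_distrib_right)
  qed simp
  finally show ?thesis by (simp add: algebra_simps)
qed

text \<open>\<open>T\<close> and the interval of the same size satisfy one and the same recursion,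
  and its left factor \<open>1 - t ^ card T\<close> can be cancelled for nonempty
  \<open>T\<close>.\<close>

lemma word_poly_card:
  fixes q t :: "'r::idom" and T :: "int set"
  assumes q: "q \<noteq> 0" "\<And>n. 0 < n \<Longrightarrow> q ^ n \<noteq> 1" and t: "\<And>n. 0 < n \<Longrightarrow> t ^ n \<noteq> 1" and "finite T"
  shows "word_poly q t T = word_poly q t {1..int (card T)}"
  using assms(4)
proof (induction "card T" arbitrary: T rule: less_induct)
  case less
  let ?n = "card T"
  let ?h = "\<lambda>m. word_poly q t {1..int m}"
  \<comment> \<open>Stated for every \<open>S\<close> of this size, so that it applies to
    \<open>T\<close> and to the interval alike.\<close>
  have *: "(1 - t ^ ?n) * word_poly q t S =
    (\<Sum>m<?n. gaussian q ?n m * t ^ m * ?h m * (\<Prod>j=Suc m..?n. 1 - t ^ j))"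
    if S: "finite S" "card S = ?n" for S :: "int set"
  proof -
    have "word_poly q t B = ?h (card B)" if "B \<subset> S" for B
      using less.hyps[of B] psubset_card_mono[OF S(1) that] finite_subset[OF psubset_imp_subset[OF that] S(1)] S(2)
      by simp
    from word_poly_card_recursion[OF q S(1) this] show ?thesis unfolding S(2) .
  qed
  show ?case
  proof (cases "?n = 0")
    case True
    then show ?thesis using less.prems by simp
  next
    case False
    have "(1 - t ^ ?n) * word_poly q t T = (1 - t ^ ?n) * ?h ?n"
      using *[of T] *[of "{1..int ?n}"] less.prems by simp
    moreover have "1 - t ^ ?n \<noteq> 0" using t[of ?n] False by simp
    ultimately show ?thesis by simp
  qed
qed

section \<open>Signed permutations as words\<close>

text \<open>The shift by d + 1 sends 1, ..., d to -d, ..., -1 and -d, ..., -1 to 1, ..., d. The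
  reordering of the letters thereby becomes the usual order of the integers, with the wall at
  0.\<close>

definition flip_letter :: "nat \<Rightarrow> int \<Rightarrow> int" where
  "flip_letter d x = (if 0 < x then x - (int d + 1) else x + (int d + 1))"

lemma flip_letter_mem: "x \<in> signed_letters d \<Longrightarrow> flip_letter d x \<in> signed_letters d"
  and flip_letter_flip: "x \<in> signed_letters d \<Longrightarrow> flip_letter d (flip_letter d x) = x"
  and flip_letter_minus: "x \<in> signed_letters d \<Longrightarrow> flip_letter d (- x) = - flip_letter d x"
  and flip_letter_pos_iff: "x \<in> signed_letters d \<Longrightarrow> 0 < flip_letter d x \<longleftrightarrow> x < 0"
  by (auto simp: flip_letter_def signed_letters_def)

lemma signed_letters_minus [simp]: "- x \<in> signed_letters d \<longleftrightarrow> x \<in> signed_letters d"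
  by (auto simp: signed_letters_def)

text \<open>The sign of the product says: compare as usual within one sign, and the other way round
  across signs. This is why the first part of \<open>signed_length\<close> counts ordinary
  inversions after the flip.\<close>

lemma flip_letter_less_iff:
  assumes "x \<in> signed_letters d" "y \<in> signed_letters d"
  shows "flip_letter d y < flip_letter d x \<longleftrightarrow> 0 < x * y * (x - y)"
proof -
  have "0 < x * y * (x - y) \<longleftrightarrow> ((0 < x \<and> 0 < y \<or> x < 0 \<and> y < 0) \<and> y < x) \<or>
     ((0 < x \<and> y < 0 \<or> x < 0 \<and> 0 < y) \<and> x < y)"
    by (auto simp: zero_less_mult_iff mult_less_0_iff)
  then show ?thesis using assms by (auto simp: flip_letter_def signed_letters_def)
qed

text \<open>Flipping letters moves the negative letters above the positive ones. This changes the
  descents exactly at the sign changes, whose positions telescope to the number of negative letters.\<close>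

lemma maj_flip_letters:
  assumes "set w \<subseteq> signed_letters d"
  shows "maj (map (flip_letter d) w @ [0]) = maj w + length (filter (\<lambda>x. x < 0) w)"
  using assms
proof (induction w rule: rev_induct)
  case (snoc x w)
  have x: "x \<in> signed_letters d" using snoc.prems by simp
  show ?case
  proof (cases w rule: rev_cases)
    case Nil
    then show ?thesis using flip_letter_pos_iff[OF x] by (simp add: maj_snoc[of "[_]", simplified])
  next
    case (snoc w' z)
    have ne: "w \<noteq> []" and lst: "last w = z" using snoc by auto
    have z: "z \<in> signed_letters d" using snoc.prems snoc by simp
    let ?f = "flip_letter d"
    have IH: "maj (map ?f w @ [0]) = maj w + length (filter (\<lambda>x. x < 0) w)"
      using snoc.IH snoc.prems by simp
    have 1: "maj (map ?f w @ [0]) = maj (map ?f w) + (if 0 < ?f z then length w else 0)"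
      using maj_snoc[of "map ?f w" 0] ne lst by (simp add: last_map)
    have 2: "maj (map ?f w @ [?f x]) = maj (map ?f w) + (if ?f x < ?f z then length w else 0)"
      using maj_snoc[of "map ?f w" "?f x"] ne lst by (simp add: last_map)
    have 3: "maj (map ?f (w @ [x]) @ [0]) = maj (map ?f w @ [?f x]) + (if 0 < ?f x then Suc (length w) else 0)"
      using maj_snoc[of "map ?f w @ [?f x]" 0] by simp
    have 4: "maj (w @ [x]) = maj w + (if x < z then length w else 0)"
      using maj_snoc[OF ne, of x] lst by simp
    have "x \<noteq> 0" "z \<noteq> 0" using x z by (auto simp: signed_letters_def)
    moreover have "?f x < ?f z \<longleftrightarrow> (if (x < 0) = (z < 0) then x < z else z < 0)"
      using x z by (auto simp: flip_letter_def signed_letters_def)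
    ultimately show ?thesis
      using IH 1 2 3 4 flip_letter_pos_iff[OF x] flip_letter_pos_iff[OF z]
      by (auto split: if_splits)
  qed
qed simp

section \<open>Signed permutations and their value lists\<close>

definition signed_word :: "nat \<Rightarrow> (int \<Rightarrow> int) \<Rightarrow> int list" where
  "signed_word d \<sigma> = map (\<lambda>i. \<sigma> (int (Suc i))) [0..<d]"

definition signed_words :: "nat \<Rightarrow> int list set" where
  "signed_words d = {w. distinct w \<and> set w \<in> transversals d}"

text \<open>Values at negative arguments follow from oddness, and everything outside the letters is
  fixed, as \<open>permutes\<close> demands. Lists are indexed from 0, hence the shift by 1.\<close>

definition word_perm :: "nat \<Rightarrow> int list \<Rightarrow> int \<Rightarrow> int" where
  "word_perm d w i = (if 0 < i \<and> i \<le> int d then w ! (nat i - 1)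
     else if i < 0 \<and> - i \<le> int d then - (w ! (nat (- i) - 1)) else i)"

lemma signed_permsD:
  assumes "\<sigma> \<in> signed_perms d"
  shows "\<sigma> permutes signed_letters d" "\<And>i. i \<in> signed_letters d \<Longrightarrow> \<sigma> (- i) = - \<sigma> i"
    "\<And>i. i \<in> signed_letters d \<Longrightarrow> \<sigma> i \<in> signed_letters d"
  using assms permutes_in_image[of \<sigma> "signed_letters d"]
  by (auto simp: signed_perms_def signed_letters_def)

lemma transversalsI:
  assumes "T \<subseteq> signed_letters d" "\<And>v. v \<in> signed_letters d \<Longrightarrow> (v \<in> T) \<noteq> (- v \<in> T)"
  shows "T \<in> transversals d"
  unfolding transversals_def by (intro CollectI conjI ballI assms)

lemma set_signed_word: "set (signed_word d \<sigma>) = \<sigma> ` {1..int d}"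
proof -
  have "(\<lambda>i. int (Suc i)) ` {0..<d} = {1..int d}"
  proof (intro equalityI subsetI)
    fix x assume "x \<in> {1..int d}"
    then show "x \<in> (\<lambda>i. int (Suc i)) ` {0..<d}"
      by (intro image_eqI[of _ _ "nat x - 1"]) auto
  qed auto
  moreover have "set (signed_word d \<sigma>) = \<sigma> ` (\<lambda>i. int (Suc i)) ` {0..<d}"
    unfolding image_image by (simp add: signed_word_def)
  ultimately show ?thesis by (simp only:)
qed

lemma signed_word_in_signed_words:
  assumes "\<sigma> \<in> signed_perms d"
  shows "signed_word d \<sigma> \<in> signed_words d"
proof -
  note D = signed_permsD[OF assms]
  have inj: "\<sigma> i = \<sigma> j \<longleftrightarrow> i = j" for i j
    using permutes_inj[OF D(1)] by (simp add: inj_eq)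
  have dist: "distinct (signed_word d \<sigma>)"
    by (auto simp: signed_word_def distinct_map inj inj_on_def)
  have sub: "\<sigma> ` {1..int d} \<subseteq> signed_letters d"
  proof (rule image_subsetI)
    fix i assume "i \<in> {1..int d}"
    then show "\<sigma> i \<in> signed_letters d" by (intro D(3)) (simp add: signed_letters_def)
  qed
  \<comment> \<open>Pulled back along \<open>\<sigma>\<close>, the claim says that exactly one of
    \<open>i\<close> and \<open>- i\<close> is positive.\<close>
  have one: "(v \<in> \<sigma> ` {1..int d}) \<noteq> (- v \<in> \<sigma> ` {1..int d})" if v: "v \<in> signed_letters d" for v
  proof -
    obtain i where i: "i \<in> signed_letters d" "v = \<sigma> i"
      using v permutes_image[OF D(1)] by blast
    then have "- v = \<sigma> (- i)" using D(2) by simp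
    then have "v \<in> \<sigma> ` {1..int d} \<longleftrightarrow> i \<in> {1..int d}" "- v \<in> \<sigma> ` {1..int d} \<longleftrightarrow> - i \<in> {1..int d}"
      using i(2) by (simp_all only: inj_image_mem_iff[OF permutes_inj[OF D(1)]])
    then show ?thesis using i(1) by (auto simp: signed_letters_def)
  qed
  show ?thesis
    using transversalsI[OF sub one] dist by (simp add: signed_words_def set_signed_word)
qed

lemma signed_wordsD:
  assumes "w \<in> signed_words d"
  shows "distinct w" "set w \<in> transversals d" "length w = d" "set w \<subseteq> signed_letters d"
    "\<And>v. v \<in> signed_letters d \<Longrightarrow> (v \<in> set w) \<noteq> (- v \<in> set w)"
proof -
  show d: "distinct w" and t: "set w \<in> transversals d" using assms by (auto simp: signed_words_def)
  show "length w = d" using card_transversal[OF t] distinct_card[OF d] by simp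
  show "set w \<subseteq> signed_letters d"
    using t by (simp add: transversals_def)
  show "(v \<in> set w) \<noteq> (- v \<in> set w)" if "v \<in> signed_letters d" for v
    using t that unfolding transversals_def mem_Collect_eq by (elim conjE bspec)
qed

lemma word_perm_in_signed_perms:
  assumes "w \<in> signed_words d"
  shows "word_perm d w \<in> signed_perms d"
proof -
  note D = signed_wordsD[OF assms]
  let ?\<sigma> = "word_perm d w"
  have nth: "w ! k \<in> set w" if "k < d" for k using that D(3) by simp
  have pos: "?\<sigma> i = w ! (nat i - 1)" "nat i - 1 < d" if "0 < i" "i \<le> int d" for i
    using that by (auto simp: word_perm_def)
  have odd: "?\<sigma> (- i) = - ?\<sigma> i" if "i \<in> signed_letters d" for i
    using that by (auto simp: word_perm_def signed_letters_def)
  \<comment> \<open>The sign of the argument can be read off the value, because \<open>set w\<close>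
    holds one letter of each pair. Injectivity thus reduces to positive arguments, where it is the
    distinctness of \<open>w\<close>.\<close>
  have in_set: "0 < i \<longleftrightarrow> ?\<sigma> i \<in> set w" if i: "i \<in> signed_letters d" for i
  proof (cases "0 < i")
    case True
    then show ?thesis using i pos[of i] nth by (simp add: signed_letters_def)
  next
    case False
    then have "?\<sigma> (- i) \<in> set w" using i pos[of "- i"] nth by (simp add: signed_letters_def)
    then have "- ?\<sigma> i \<in> set w" using odd[OF i] by simp
    then have "?\<sigma> i \<notin> set w" using D(4) D(5)[of "- ?\<sigma> i"] by (metis minus_minus subsetD)
    then show ?thesis using False by simp
  qed
  have mem: "?\<sigma> i \<in> signed_letters d" if i: "i \<in> signed_letters d" for i
  proof (cases "0 < i")
    case True
    then show ?thesis using in_set[OF i] D(4) by auto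
  next
    case False
    then have "- i \<in> signed_letters d" "0 < - i" using i by (auto simp: signed_letters_def)
    then have "?\<sigma> (- i) \<in> signed_letters d" using in_set[of "- i"] D(4) by blast
    then show ?thesis using odd[OF i] by simp
  qed
  have inj_pos: "i = j" if "0 < i" "i \<le> int d" "0 < j" "j \<le> int d" "?\<sigma> i = ?\<sigma> j" for i j
  proof -
    have "nat i - 1 = nat j - 1"
      using that pos[of i] pos[of j] nth_eq_iff_index_eq[OF D(1)] D(3) by metis
    then show ?thesis using that by linarith
  qed
  have "inj_on ?\<sigma> (signed_letters d)"
  proof (rule inj_onI)
    fix i j assume i: "i \<in> signed_letters d" and j: "j \<in> signed_letters d" and eq: "?\<sigma> i = ?\<sigma> j"
    then have sgn: "0 < i \<longleftrightarrow> 0 < j" using in_set by metis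
    show "i = j"
    proof (cases "0 < i")
      case True
      then show ?thesis using inj_pos i j sgn eq by (auto simp: signed_letters_def)
    next
      case False
      then have "- i = - j"
        using inj_pos[of "- i" "- j"] i j sgn eq odd[OF i] odd[OF j] by (auto simp: signed_letters_def)
      then show ?thesis by simp
    qed
  qed
  then have "bij_betw ?\<sigma> (signed_letters d) (signed_letters d)"
    unfolding bij_betw_def using mem endo_inj_surj[OF finite_signed_letters] by blast
  then have "?\<sigma> permutes signed_letters d"
    by (rule bij_imp_permutes) (auto simp: word_perm_def signed_letters_def)
  then show ?thesis using odd by (simp add: signed_perms_def signed_letters_def)
qed

lemma word_perm_signed_word:
  assumes "\<sigma> \<in> signed_perms d"
  shows "word_perm d (signed_word d \<sigma>) = \<sigma>"
proof
  fix i
  note D = signed_permsD[OF assms]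
  consider "0 < i" "i \<le> int d" | "i < 0" "- i \<le> int d" | "i \<notin> signed_letters d"
    unfolding signed_letters_def by fastforce
  then show "word_perm d (signed_word d \<sigma>) i = \<sigma> i"
  proof cases
    case 1
    then have "int (Suc (nat i - 1)) = i" by simp
    moreover have "nat i - 1 < d" using 1 by auto
    ultimately show ?thesis using 1 by (simp add: word_perm_def signed_word_def)
  next
    case 2
    then have "int (Suc (nat (- i) - 1)) = - i" "- i \<in> signed_letters d" by (auto simp: signed_letters_def)
    moreover have "nat (- i) - 1 < d" using 2 by auto
    ultimately show ?thesis using 2 D(2)[of i] by (simp add: word_perm_def signed_word_def)
  next
    case 3
    then show ?thesis using permutes_not_in[OF D(1)] by (auto simp: word_perm_def signed_letters_def)
  qed
qed

lemma signed_word_word_perm: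
  assumes "w \<in> signed_words d"
  shows "signed_word d (word_perm d w) = w"
proof (rule nth_equalityI)
  show "length (signed_word d (word_perm d w)) = length w"
    using signed_wordsD(3)[OF assms] by (simp add: signed_word_def)
  fix i assume "i < length (signed_word d (word_perm d w))"
  then have "i < d" by (simp add: signed_word_def)
  moreover have "nat (int (Suc i)) - 1 = i" unfolding nat_int by simp
  ultimately show "signed_word d (word_perm d w) ! i = w ! i"
    by (simp add: signed_word_def word_perm_def del: of_nat_Suc)
qed

text \<open>The flip makes the product condition an ordinary inversion, and it sends a negative
  value to the positive letter \<open>int d + 1 + \<sigma> i\<close>, which is its summand in the
  second part.\<close>

lemma signed_length_eq:
  assumes "\<sigma> \<in> signed_perms d"
  defines "w \<equiv> map (flip_letter d) (signed_word d \<sigma>)"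
  shows "signed_length d \<sigma> = inversions w + positive_sum (set w)"
proof -
  note D = signed_permsD[OF assms(1)]
  have letter: "\<sigma> i \<in> signed_letters d" if "0 < i" "i \<le> int d" for i
    using D(3)[of i] that by (simp add: signed_letters_def)
  have len: "length w = d" by (simp add: w_def signed_word_def)
  have nth: "w ! i = flip_letter d (\<sigma> (int (Suc i)))" if "i < d" for i
    using that by (simp add: w_def signed_word_def)
  have "card {(i, j). 0 < i \<and> i < j \<and> j \<le> int d \<and> \<sigma> i * \<sigma> j * (\<sigma> i - \<sigma> j) > 0} = inversions w"
    unfolding inversions_def len
  proof (rule bij_betw_same_card[symmetric], rule bij_betw_byWitness[where
        f = "\<lambda>(i, j). (int (Suc i), int (Suc j))" and f' = "\<lambda>(i, j). (nat i - 1, nat j - 1)"])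
    show "\<forall>a\<in>{(i, j). i < j \<and> j < d \<and> w ! j < w ! i}.
       (case case a of (i, j) \<Rightarrow> (int (Suc i), int (Suc j)) of (i, j) \<Rightarrow> (nat i - 1, nat j - 1)) = a"
      by auto
    show "\<forall>a'\<in>{(i, j). 0 < i \<and> i < j \<and> j \<le> int d \<and> 0 < \<sigma> i * \<sigma> j * (\<sigma> i - \<sigma> j)}.
       (case case a' of (i, j) \<Rightarrow> (nat i - 1, nat j - 1) of (i, j) \<Rightarrow> (int (Suc i), int (Suc j))) = a'"
      by auto
    show "(\<lambda>(i, j). (int (Suc i), int (Suc j))) ` {(i, j). i < j \<and> j < d \<and> w ! j < w ! i}
      \<subseteq> {(i, j). 0 < i \<and> i < j \<and> j \<le> int d \<and> 0 < \<sigma> i * \<sigma> j * (\<sigma> i - \<sigma> j)}"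
    proof clarify
      fix i j assume a: "i < j" "j < d" "w ! j < w ! i"
      then have "0 < \<sigma> (int (Suc i)) * \<sigma> (int (Suc j)) * (\<sigma> (int (Suc i)) - \<sigma> (int (Suc j)))"
        using flip_letter_less_iff[OF letter[of "int (Suc i)"] letter[of "int (Suc j)"]]
        by (simp add: nth del: of_nat_Suc)
      then show "0 < int (Suc i) \<and> int (Suc i) < int (Suc j) \<and> int (Suc j) \<le> int d \<and>
         0 < \<sigma> (int (Suc i)) * \<sigma> (int (Suc j)) * (\<sigma> (int (Suc i)) - \<sigma> (int (Suc j)))"
        using a by simp
    qed
    show "(\<lambda>(i, j). (nat i - 1, nat j - 1)) ` {(i, j). 0 < i \<and> i < j \<and> j \<le> int d \<and> 0 < \<sigma> i * \<sigma> j * (\<sigma> i - \<sigma> j)}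
       \<subseteq> {(i, j). i < j \<and> j < d \<and> w ! j < w ! i}"
    proof clarify
      fix i j assume a: "0 < i" "i < j" "j \<le> int d" "0 < \<sigma> i * \<sigma> j * (\<sigma> i - \<sigma> j)"
      have "int (Suc (nat i - 1)) = i" "int (Suc (nat j - 1)) = j" "nat i - 1 < d" "nat j - 1 < d"
        using a by auto
      then have "w ! (nat j - 1) < w ! (nat i - 1)"
        using flip_letter_less_iff[OF letter[of i] letter[of j]] a
        by (simp add: nth del: of_nat_Suc)
      then show "nat i - 1 < nat j - 1 \<and> nat j - 1 < d \<and> w ! (nat j - 1) < w ! (nat i - 1)"
        using a by auto
    qed
  qed
  moreover have "(\<Sum>i | 1 \<le> i \<and> i \<le> int d \<and> \<sigma> i < 0. nat (int d + 1 + \<sigma> i)) = positive_sum (set w)"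
    unfolding positive_sum_def
  proof (rule sum.reindex_cong[symmetric, where l = "\<lambda>i. flip_letter d (\<sigma> i)"])
    have inj: "\<sigma> i = \<sigma> j \<longleftrightarrow> i = j" for i j
      using permutes_inj[OF D(1)] by (simp add: inj_eq)
    show "inj_on (\<lambda>i. flip_letter d (\<sigma> i)) {i. 1 \<le> i \<and> i \<le> int d \<and> \<sigma> i < 0}"
    proof (rule inj_onI)
      fix i j assume a: "i \<in> {i. 1 \<le> i \<and> i \<le> int d \<and> \<sigma> i < 0}" "j \<in> {i. 1 \<le> i \<and> i \<le> int d \<and> \<sigma> i < 0}"
        "flip_letter d (\<sigma> i) = flip_letter d (\<sigma> j)"
      then have "\<sigma> i = \<sigma> j" by (simp add: flip_letter_def)
      then show "i = j" using inj by simp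
    qed
    show "{x. x \<in> set w \<and> 0 < x} = (\<lambda>i. flip_letter d (\<sigma> i)) ` {i. 1 \<le> i \<and> i \<le> int d \<and> \<sigma> i < 0}"
      using letter by (auto simp: w_def set_signed_word flip_letter_pos_iff)
  qed (auto simp: flip_letter_def)
  ultimately show ?thesis by (simp add: signed_length_def)
qed

text \<open>On the unflipped word the two parts of \<open>Wmaj\<close> are the usual major index and
  the number of negative letters; the wall appended after the flip absorbs the latter.\<close>

lemma Wmaj_eq:
  assumes "\<sigma> \<in> signed_perms d"
  shows "Wmaj d \<sigma> = maj (map (flip_letter d) (signed_word d \<sigma>) @ [0])"
proof -
  note D = signed_permsD[OF assms(1)]
  let ?w = "signed_word d \<sigma>"
  have len: "length ?w = d" by (simp add: signed_word_def)
  have nth: "?w ! i = \<sigma> (int (Suc i))" if "i < d" for i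
    using that by (simp add: signed_word_def)
  have "(\<Sum>i | 1 \<le> i \<and> i < int d \<and> \<sigma> i > \<sigma> (i + 1). nat i) = maj ?w"
    unfolding maj_def len
  proof (rule sum.reindex_bij_witness[where i = "\<lambda>k. int (Suc k)" and j = "\<lambda>i. nat i - 1"])
    fix i assume a: "i \<in> {i. 1 \<le> i \<and> i < int d \<and> \<sigma> i > \<sigma> (i + 1)}"
    then have 1: "int (Suc (nat i - 1)) = i" "Suc (nat i - 1) < d" "int (Suc (Suc (nat i - 1))) = i + 1"
      by auto
    show "nat i - 1 \<in> {i. Suc i < d \<and> ?w ! Suc i < ?w ! i}"
      using a 1(2) unfolding mem_Collect_eq nth[OF 1(2)] nth[OF Suc_lessD[OF 1(2)]] 1(1,3) by blast
  next
    fix k assume a: "k \<in> {i. Suc i < d \<and> ?w ! Suc i < ?w ! i}"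
    then have "\<sigma> (int (Suc (Suc k))) < \<sigma> (int (Suc k))"
      using nth[of k] nth[of "Suc k"] by simp
    moreover have "int (Suc (Suc k)) = int (Suc k) + 1" by simp
    ultimately show "int (Suc k) \<in> {i. 1 \<le> i \<and> i < int d \<and> \<sigma> (i + 1) < \<sigma> i}"
      using a by simp
  qed auto
  moreover have "card {i. 1 \<le> i \<and> i \<le> int d \<and> \<sigma> i < 0} = length (filter (\<lambda>x. x < 0) ?w)"
  proof -
    have "length (filter (\<lambda>x. x < 0) ?w) = card {i. i < d \<and> \<sigma> (int (Suc i)) < 0}"
      unfolding length_filter_conv_card len by (rule arg_cong[of _ _ card]) (use nth in auto)
    also have "\<dots> = card {i. 1 \<le> i \<and> i \<le> int d \<and> \<sigma> i < 0}"
      by (rule bij_betw_same_card[of "\<lambda>k. int (Suc k)"], rule bij_betw_byWitness[where f' = "\<lambda>i. nat i - 1"])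
        auto
    finally show ?thesis by simp
  qed
  moreover have "set ?w \<subseteq> signed_letters d"
    using signed_wordsD(4)[OF signed_word_in_signed_words[OF assms]] .
  ultimately show ?thesis by (simp add: Wmaj_def maj_flip_letters)
qed

text \<open>The flip is an involution commuting with negation, so it permutes the pairs
  \<open>v\<close>, \<open>- v\<close> and preserves transversals.\<close>

lemma flip_signed_words:
  assumes "w \<in> signed_words d"
  shows "map (flip_letter d) w \<in> signed_words d" "map (flip_letter d) (map (flip_letter d) w) = w"
proof -
  note D = signed_wordsD[OF assms]
  show inv: "map (flip_letter d) (map (flip_letter d) w) = w"
    unfolding map_map by (rule map_idI) (use D(4) flip_letter_flip in auto)
  have "inj_on (flip_letter d) (set w)"
    by (rule inj_on_inverseI[of _ "flip_letter d"]) (use D(4) flip_letter_flip in auto)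
  then have dist: "distinct (map (flip_letter d) w)" using D(1) by (simp add: distinct_map)
  have mem: "v \<in> set (map (flip_letter d) w) \<longleftrightarrow> flip_letter d v \<in> set w"
    if v: "v \<in> signed_letters d" for v
    unfolding set_map using D(4) flip_letter_flip[OF v] flip_letter_flip[of _ d]
    by (metis (no_types, lifting) image_iff subsetD)
  have sub: "set (map (flip_letter d) w) \<subseteq> signed_letters d"
    using D(4) flip_letter_mem by auto
  have one: "(v \<in> set (map (flip_letter d) w)) \<noteq> (- v \<in> set (map (flip_letter d) w))"
    if v: "v \<in> signed_letters d" for v
    using D(5)[OF flip_letter_mem[OF v]] v
    unfolding mem[OF v] mem[OF signed_letters_minus[THEN iffD2, OF v]] flip_letter_minus[OF v] by blast
  show "map (flip_letter d) w \<in> signed_words d"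
    using transversalsI[OF sub one] dist by (simp add: signed_words_def)
qed

lemma M_signed_words:
  "M_signed q d = (\<Sum>w\<in>signed_words d.
     of_nat q ^ (inversions w + positive_sum (set w)) * fps_X ^ maj (w @ [0]))"
  unfolding M_signed_def
proof (rule sum.reindex_bij_witness[where
      j = "\<lambda>\<sigma>. map (flip_letter d) (signed_word d \<sigma>)" and i = "\<lambda>w. word_perm d (map (flip_letter d) w)"])
qed (simp_all add: flip_signed_words signed_word_in_signed_words word_perm_signed_word
      word_perm_in_signed_perms signed_word_word_perm signed_length_eq Wmaj_eq del: map_map)

lemma fps_X_power_neq_1: "0 < n \<Longrightarrow> fps_X ^ n \<noteq> (1 :: rat fps)"
  by (metis fps_X_power_nth fps_one_nth less_irrefl zero_neq_one)

text \<open>For each letter set \<open>T\<close> the wall formula at 0 gives subsets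
  \<open>B\<close> with negative complement \<open>C\<close>, and the pairs of blocks become the
  index of summation. \<open>B\<close> enters the word polynomial only through its size, so the
  other weights collect to \<open>split_poly\<close>. The bound on \<open>q\<close> ensures that no
  positive power of it is 1.\<close>

lemma M_signed_expansion:
  fixes q d :: nat
  defines "Q \<equiv> of_nat q :: rat fps"
  assumes "2 \<le> q"
  shows "M_signed q d = (\<Sum>m\<le>d. split_poly Q d m * fps_X ^ m *
    word_poly Q fps_X {1..int m} * (\<Prod>j=Suc m..d. 1 - fps_X ^ j))"
proof -
  have "Q \<noteq> 0" using assms by (simp add: Q_def)
  have Q1: "Q ^ n \<noteq> 1" if "0 < n" for n
  proof -
    have "q ^ n \<noteq> 1" using assms that by simp
    then show ?thesis unfolding Q_def by (metis of_nat_1 of_nat_eq_iff of_nat_power)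
  qed
  let ?P = "\<lambda>m. \<Prod>j=Suc m..d. 1 - (fps_X :: rat fps) ^ j"
  have words: "signed_words d = (\<Union>T\<in>transversals d. permutations_of_set T)"
    by (auto simp: signed_words_def permutations_of_set_def)
  have fin: "finite T" if "T \<in> transversals d" for T by (rule finite_transversal[OF that])
  have zero: "0 \<notin> T" if "T \<in> transversals d" for T
    using that by (auto simp: transversals_def signed_letters_def)
  let ?\<B> = "\<lambda>T. {B. B \<subseteq> T \<and> T - B \<subseteq> {..<0}}"
  have "M_signed q d = (\<Sum>T\<in>transversals d. \<Sum>w\<in>permutations_of_set T.
       Q ^ (inversions w + positive_sum (set w)) * fps_X ^ maj (w @ [0]))"
    unfolding M_signed_words words Q_def
    by (rule sum.UNION_disjoint) (auto dest: permutations_of_setD(1) simp: fin)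
  also have "\<dots> = (\<Sum>T\<in>transversals d. \<Sum>B\<in>?\<B> T. Q ^ positive_sum T * (Q ^ cross_inversions B (T - B) * fps_X ^ card B *
        word_poly Q fps_X B * ?P (card B)))"
  proof (rule sum.cong)
    fix T assume T: "T \<in> transversals d"
    have "(\<Sum>w\<in>permutations_of_set T. Q ^ (inversions w + positive_sum (set w)) * fps_X ^ maj (w @ [0])) =
      Q ^ positive_sum T * (\<Sum>w\<in>permutations_of_set T. Q ^ inversions w * fps_X ^ maj (w @ [0]))"
      unfolding sum_distrib_left
      by (rule sum.cong) (auto simp: permutations_of_set_def power_add mult_ac)
    then show "(\<Sum>w\<in>permutations_of_set T. Q ^ (inversions w + positive_sum (set w)) * fps_X ^ maj (w @ [0])) =
      (\<Sum>B\<in>?\<B> T. Q ^ positive_sum T * (Q ^ cross_inversions B (T - B) * fps_X ^ card B *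
        word_poly Q fps_X B * ?P (card B)))"
      by (simp add: word_poly_wall[OF fin[OF T] zero[OF T]] card_transversal[OF T] sum_distrib_left)
  qed simp
  also have "\<dots> = (\<Sum>(T, B)\<in>(SIGMA T:transversals d. ?\<B> T). Q ^ positive_sum T * (Q ^ cross_inversions B (T - B) * fps_X ^ card B *
        word_poly Q fps_X B * ?P (card B)))"
    by (rule sum.Sigma) (use fin in \<open>auto intro: finite_subset[of _ "Pow _"]\<close>)
  also have "\<dots> = (\<Sum>(m, B, C)\<in>(SIGMA m:{..d}. split_transversals d m).
       Q ^ (cross_inversions B C + positive_sum B) * (fps_X ^ m * word_poly Q fps_X {1..int m} * ?P m))"
  proof (rule sum.reindex_bij_witness[where
        j = "\<lambda>(T, B). (card B, B, T - B)" and i = "\<lambda>(m, B, C). (B \<union> C, B)"])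
    fix p assume "p \<in> (SIGMA T:transversals d. ?\<B> T)"
    then obtain T B where p: "p = (T, B)" and T: "T \<in> transversals d" and B: "B \<subseteq> T" "T - B \<subseteq> {..<0}"
      by blast
    have un: "B \<union> (T - B) = T" using B by auto
    have fB: "finite B" using fin[OF T] B finite_subset by blast
    show "(case case p of (T, B) \<Rightarrow> (card B, B, T - B) of (m, B, C) \<Rightarrow> (B \<union> C, B)) = p"
      using un by (simp add: p)
    show "(case p of (T, B) \<Rightarrow> (card B, B, T - B)) \<in> (SIGMA m:{..d}. split_transversals d m)"
      using card_mono[OF fin[OF T] B(1)] card_transversal[OF T] un T B
      by (auto simp: p split_transversals_def)
    \<comment> \<open>The part behind the cut is negative, so every positive letter of
      \<open>T\<close> is in \<open>B\<close>.\<close>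
    have "{x. x \<in> T \<and> 0 < x} = {x. x \<in> B \<and> 0 < x}" using B by force
    then have "positive_sum T = positive_sum B" by (simp add: positive_sum_def)
    then show "(case case p of (T, B) \<Rightarrow> (card B, B, T - B) of
          (m, B, C) \<Rightarrow> Q ^ (cross_inversions B C + positive_sum B) * (fps_X ^ m * word_poly Q fps_X {1..int m} * ?P m)) =
       (case p of (T, B) \<Rightarrow> Q ^ positive_sum T * (Q ^ cross_inversions B (T - B) * fps_X ^ card B *
        word_poly Q fps_X B * ?P (card B)))"
      by (simp add: p power_add mult_ac word_poly_card[OF \<open>Q \<noteq> 0\<close> Q1 fps_X_power_neq_1 fB])
  next
    fix p assume "p \<in> (SIGMA m:{..d}. split_transversals d m)"
    then obtain m B C where p: "p = (m, B, C)" and BC: "(B, C) \<in> split_transversals d m"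
      by auto
    note D = split_transversalsD[OF BC]
    have 1: "B \<union> C - B = C" using D(6) by auto
    show "(case case p of (m, B, C) \<Rightarrow> (B \<union> C, B) of (T, B) \<Rightarrow> (card B, B, T - B)) = p"
      using D(3) 1 by (simp add: p)
    show "(case p of (m, B, C) \<Rightarrow> (B \<union> C, B)) \<in> (SIGMA T:transversals d. ?\<B> T)"
      using BC 1 by (simp add: p split_transversals_def)
  qed
  also have "\<dots> = (\<Sum>m\<le>d. \<Sum>(B, C)\<in>split_transversals d m.
       Q ^ (cross_inversions B C + positive_sum B) * (fps_X ^ m * word_poly Q fps_X {1..int m} * ?P m))"
    by (subst sum.Sigma) (simp_all add: case_prod_unfold)
  also have "\<dots> = (\<Sum>m\<le>d. split_poly Q d m * (fps_X ^ m * word_poly Q fps_X {1..int m} * ?P m))"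
    by (simp add: split_poly_def sum_distrib_right case_prod_unfold)
  finally show ?thesis by (simp add: mult.assoc)
qed

section \<open>Counting subspaces and isotropic subspaces\<close>

text \<open>Lists grow at the head, and the number of admissible heads depends only on the length
  reached. Both ordered bases of subspaces and those of isotropic subspaces are counted this
  way.\<close>

lemma card_lists_by_extension:
  assumes "L 0 = {[]}"
    and "\<And>m. L (Suc m) = {x # xs |x xs. xs \<in> L m \<and> x \<in> E xs}"
    and "\<And>m xs. m < n \<Longrightarrow> xs \<in> L m \<Longrightarrow> finite (E xs) \<and> card (E xs) = c m"
    and "m \<le> n"
  shows "finite (L m) \<and> card (L m) = (\<Prod>i<m. c i)"
  using assms(4)
proof (induction m)
  case 0
  then show ?case by (simp add: assms(1))
next
  case (Suc m)
  have "L (Suc m) = (\<lambda>(xs, x). x # xs) ` (SIGMA xs:L m. E xs)"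
    unfolding assms(2) by auto
  moreover have "inj_on (\<lambda>(xs, x). x # xs) (SIGMA xs:L m. E xs)"
    by (auto simp: inj_on_def)
  ultimately show ?case
    using Suc assms(3)[of m] by (auto simp: card_image intro!: finite_SigmaI)
qed

section \<open>Subspaces over a finite field\<close>

locale finite_field_space = vector_space scale
  for scale :: "'a::{field,finite} \<Rightarrow> 'v::ab_group_add \<Rightarrow> 'v"
begin

lemma card_span_insert:
  assumes "finite (span S)" "a \<notin> span S"
  shows "finite (span (insert a S))" "card (span (insert a S)) = CARD('a) * card (span S)"
proof -
  let ?f = "\<lambda>(k, y). scale k a + y"
  have img: "span (insert a S) = ?f ` (UNIV \<times> span S)"
  proof (intro equalityI subsetI)
    fix x assume "x \<in> span (insert a S)"
    then obtain k where "x - scale k a \<in> span S" by (auto simp: span_breakdown_eq)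
    then show "x \<in> ?f ` (UNIV \<times> span S)"
      by (intro image_eqI[of _ _ "(k, x - scale k a)"]) auto
  next
    fix x assume "x \<in> ?f ` (UNIV \<times> span S)"
    then obtain k y where "x = scale k a + y" "y \<in> span S" by auto
    then show "x \<in> span (insert a S)" unfolding span_breakdown_eq by (intro exI[of _ k]) simp
  qed
  have "inj_on ?f (UNIV \<times> span S)"
  proof (rule inj_onI, clarify)
    fix k y k' y' assume y: "y \<in> span S" "y' \<in> span S" and eq: "scale k a + y = scale k' a + y'"
    have "scale (k - k') a = y' - y" using eq by (simp add: scale_left_diff_distrib algebra_simps)
    then have m: "scale (k - k') a \<in> span S" using y by (simp add: span_diff)
    have "k = k'"
    proof (rule ccontr)
      assume "k \<noteq> k'"
      then have "scale (inverse (k - k')) (scale (k - k') a) = a" by simp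
      then show False using span_scale[OF m, of "inverse (k - k')"] assms(2) by simp
    qed
    then show "k = k' \<and> y = y'" using eq by simp
  qed
  then show "finite (span (insert a S))" "card (span (insert a S)) = CARD('a) * card (span S)"
    unfolding img using assms(1) by (simp_all add: card_image card_cartesian_product)
qed

lemma card_span_independent:
  assumes "finite B" "independent B"
  shows "finite (span B) \<and> card (span B) = CARD('a) ^ card B"
  using assms
proof (induction B)
  case (insert a B)
  then have "a \<notin> span B" "independent B" by (auto simp: independent_insert)
  then show ?case using insert card_span_insert[of B a] by simp
qed simp

lemma card_subspace:
  assumes "subspace U" "finite U"
  shows "card U = CARD('a) ^ dim U"
proof -
  obtain B where B: "B \<subseteq> U" "independent B" "U \<subseteq> span B" "card B = dim U"
    using basis_exists by blast
  have "span B = U" using B span_minimal[OF B(1) assms(1)] by auto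
  moreover have "finite B" using B(1) assms(2) finite_subset by blast
  ultimately show ?thesis using card_span_independent[of B] B by simp
qed

lemma field_card_gt_1: "1 < CARD('a)"
proof -
  have "card {0, 1 :: 'a} \<le> CARD('a)" by (rule card_mono) auto
  then show ?thesis by simp
qed

text \<open>Lists rather than sets: their number is a plain product, and each subspace of dimension
  \<open>m\<close> is overcounted by the same factor.\<close>

definition independent_lists :: "'v set \<Rightarrow> nat \<Rightarrow> 'v list set" where
  "independent_lists U m = {xs. length xs = m \<and> distinct xs \<and> independent (set xs) \<and> set xs \<subseteq> U}"

lemma independent_lists_Suc:
  "independent_lists U (Suc m) =
    {x # xs |x xs. xs \<in> independent_lists U m \<and> x \<in> U - span (set xs)}"
  (is "?L = ?R")
proof (intro equalityI subsetI)
  fix ys assume ys: "ys \<in> ?L"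
  then obtain x xs where "ys = x # xs" by (auto simp: independent_lists_def length_Suc_conv)
  with ys show "ys \<in> ?R" by (auto simp: independent_lists_def independent_insert)
next
  fix ys assume "ys \<in> ?R"
  then obtain x xs where ys: "ys = x # xs" "xs \<in> independent_lists U m" "x \<in> U" "x \<notin> span (set xs)"
    by blast
  then have "independent (insert x (set xs))"
    by (intro independent_insertI) (simp_all add: independent_lists_def)
  then show "ys \<in> ?L" using ys span_base[of x "set xs"] by (auto simp: independent_lists_def)
qed

lemma independent_listsD:
  assumes "xs \<in> independent_lists U m"
  shows "subspace (span (set xs))" "finite (span (set xs))" "card (span (set xs)) = CARD('a) ^ m"
    "dim (span (set xs)) = m" "subspace U \<Longrightarrow> span (set xs) \<subseteq> U"
proof -
  have xs: "length xs = m" "distinct xs" "independent (set xs)" "set xs \<subseteq> U"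
    using assms by (auto simp: independent_lists_def)
  then have "card (set xs) = m" by (simp add: distinct_card)
  then show "finite (span (set xs))" "card (span (set xs)) = CARD('a) ^ m" "dim (span (set xs)) = m"
    using card_span_independent[of "set xs"] xs(3) by (simp_all add: dim_eq_card_independent)
  show "span (set xs) \<subseteq> U" if "subspace U" using span_minimal[OF xs(4) that] .
qed simp

lemma card_independent_lists:
  assumes "subspace U" "finite U" "m \<le> dim U"
  shows "finite (independent_lists U m) \<and>
    card (independent_lists U m) = (\<Prod>i<m. CARD('a) ^ dim U - CARD('a) ^ i)"
proof (rule card_lists_by_extension[where n = "dim U" and E = "\<lambda>xs. U - span (set xs)"])
  show "independent_lists U 0 = {[]}" by (auto simp: independent_lists_def independent_empty)
  fix k xs assume "xs \<in> independent_lists U k"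
  note D = independent_listsD[OF this]
  show "finite (U - span (set xs)) \<and> card (U - span (set xs)) = CARD('a) ^ dim U - CARD('a) ^ k"
    using assms D by (simp add: card_Diff_subset card_subspace)
qed (use assms independent_lists_Suc in auto)

lemma span_independent_list:
  assumes "subspace W" "finite W" "dim W = m" "xs \<in> independent_lists W m"
  shows "span (set xs) = W"
  using independent_listsD[OF assms(4)] card_subspace[OF assms(1,2)] assms
  by (intro card_subset_eq) auto

text \<open>Double counting: a list of length \<open>m\<close> determines the subspace of dimension
  \<open>m\<close> that it spans, and all such subspaces have equally many ordered bases.\<close>

lemma card_subspaces_independent_lists:
  assumes fin: "finite \<W>" and W: "\<And>W. W \<in> \<W> \<Longrightarrow> subspace W \<and> finite W \<and> dim W = m"
    and L: "L = (\<Union>W\<in>\<W>. independent_lists W m)"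
  shows "card L = card \<W> * (\<Prod>i<m. CARD('a) ^ m - CARD('a) ^ i)"
proof -
  have "card L = (\<Sum>W\<in>\<W>. card (independent_lists W m))"
    unfolding L
  proof (rule card_UN_disjoint[OF fin])
    show "\<forall>W\<in>\<W>. finite (independent_lists W m)"
      using W card_independent_lists by (metis order_refl)
    show "\<forall>W\<in>\<W>. \<forall>W'\<in>\<W>. W \<noteq> W' \<longrightarrow> independent_lists W m \<inter> independent_lists W' m = {}"
      using W span_independent_list by (metis disjoint_iff)
  qed
  also have "\<dots> = (\<Sum>W\<in>\<W>. \<Prod>i<m. CARD('a) ^ m - CARD('a) ^ i)"
    by (rule sum.cong) (use W card_independent_lists[of _ m] in auto)
  finally show ?thesis by simp
qed

lemma card_subspaces_of_dim:
  assumes "subspace U" "finite U" "m \<le> dim U"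
  shows "card {W. subspace W \<and> W \<subseteq> U \<and> dim W = m} * (\<Prod>i<m. CARD('a) ^ m - CARD('a) ^ i)
    = (\<Prod>i<m. CARD('a) ^ dim U - CARD('a) ^ i)"
proof -
  let ?\<W> = "{W. subspace W \<and> W \<subseteq> U \<and> dim W = m}"
  have "independent_lists U m = (\<Union>W\<in>?\<W>. independent_lists W m)"
  proof (intro equalityI subsetI)
    fix xs assume xs: "xs \<in> independent_lists U m"
    then have "span (set xs) \<in> ?\<W>" using independent_listsD[OF xs] assms(1) by auto
    moreover have "xs \<in> independent_lists (span (set xs)) m"
      using xs by (auto simp: independent_lists_def span_base)
    ultimately show "xs \<in> (\<Union>W\<in>?\<W>. independent_lists W m)" by blast
  qed (auto simp: independent_lists_def)
  moreover have "finite ?\<W>" by (rule finite_subset[of _ "Pow U"]) (use assms in auto)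
  moreover have "finite W" if "W \<subseteq> U" for W using that assms finite_subset by blast
  ultimately have "card (independent_lists U m) = card ?\<W> * (\<Prod>i<m. CARD('a) ^ m - CARD('a) ^ i)"
    by (intro card_subspaces_independent_lists) auto
  then show ?thesis using card_independent_lists[OF assms] by simp
qed

end

section \<open>Orthogonal complements and isotropic subspaces\<close>

locale finite_symplectic_space = symplectic_space scale V \<omega> d + finite_field_space scale
  for scale :: "'a::{field,finite} \<Rightarrow> 'v::ab_group_add \<Rightarrow> 'v" and V \<omega> d
begin

lemma subspace_V: "subspace V"
  using basis subspace_span by blast

lemma finite_V: "finite V" and card_V: "card V = CARD('a) ^ (2 * d)" and dim_V: "dim V = 2 * d"
proof -
  obtain B where B: "finite B" "independent B" "span B = V" "card B = 2 * d"
    using basis by blast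
  show "finite V" "card V = CARD('a) ^ (2 * d)" using card_span_independent[OF B(1,2)] B by auto
  show "dim V = 2 * d" using dim_span_eq_card_independent[OF B(2)] B by simp
qed

definition perp :: "'v set \<Rightarrow> 'v set" where
  "perp S = {x \<in> V. \<forall>y\<in>S. \<omega> x y = 0}"

lemma omega_zero: "x \<in> V \<Longrightarrow> \<omega> x 0 = 0" "x \<in> V \<Longrightarrow> \<omega> 0 x = 0"
  using scale_right[of x x 0] scale_left[of x x 0] by auto

lemma omega_diff_left:
  assumes "x \<in> V" "y \<in> V" "z \<in> V"
  shows "\<omega> (x - y) z = \<omega> x z - \<omega> y z"
  using add_left[of "x - y" y z] assms subspace_diff[OF subspace_V] by simp

lemma omega_commute_zero:
  assumes "x \<in> V" "y \<in> V" "\<omega> x y = 0"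
  shows "\<omega> y x = 0"
proof -
  have "x + y \<in> V" using assms subspace_add[OF subspace_V] by blast
  then show ?thesis
    using alternating[of "x + y"] alternating[of x] alternating[of y] assms
    by (simp add: add_left add_right)
qed

lemma perp_span:
  assumes "S \<subseteq> V"
  shows "perp (span S) = perp S"
proof (intro equalityI subsetI)
  fix x assume x: "x \<in> perp S"
  then have xV: "x \<in> V" by (simp add: perp_def)
  have "subspace {y \<in> V. \<omega> x y = 0}"
    using xV subspace_V by (auto simp: subspace_def omega_zero add_right scale_right)
  moreover have "S \<subseteq> {y \<in> V. \<omega> x y = 0}" using x assms by (auto simp: perp_def)
  ultimately have "span S \<subseteq> {y \<in> V. \<omega> x y = 0}" by (intro span_minimal)
  then show "x \<in> perp (span S)" using xV by (auto simp: perp_def)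
qed (auto simp: perp_def span_base)

lemma finite_perp: "finite (perp S)"
  by (rule finite_subset[OF _ finite_V]) (auto simp: perp_def)

text \<open>Pairing with \<open>a\<close> splits \<open>perp S\<close> into at most as many fibres
  as there are scalars. Subtracting a fixed point embeds a nonempty fibre into
  \<open>perp (insert a S)\<close>.\<close>

lemma card_perp_insert:
  assumes "a \<in> V" "S \<subseteq> V"
  shows "card (perp S) \<le> CARD('a) * card (perp (insert a S))"
proof -
  let ?A = "\<lambda>c. {x \<in> perp S. \<omega> x a = c}"
  have bound: "card (?A c) \<le> card (perp (insert a S))" for c
  proof (cases "?A c = {}")
    case True
    then show ?thesis by (simp only: card.empty)
  next
    case False
    then obtain z where z: "z \<in> perp S" "\<omega> z a = c" by auto
    show ?thesis
    proof (rule card_inj_on_le[of "\<lambda>x. x - z"])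
      show "(\<lambda>x. x - z) ` ?A c \<subseteq> perp (insert a S)"
        using z assms subspace_diff[OF subspace_V]
        by (auto simp: perp_def omega_diff_left subset_iff)
    qed (auto simp: inj_on_def finite_perp)
  qed
  have "perp S = (\<Union>c. ?A c)" by auto
  then have "card (perp S) = card (\<Union>c. ?A c)" by simp
  also have "\<dots> = (\<Sum>c\<in>UNIV. card (?A c))"
    by (rule card_UN_disjoint) (auto simp: finite_perp)
  also have "\<dots> \<le> (\<Sum>c\<in>(UNIV::'a set). card (perp (insert a S)))"
    by (rule sum_mono) (rule bound)
  finally show ?thesis by simp
qed

lemma card_perp_Un:
  assumes "finite T" "T \<subseteq> V" "S \<subseteq> V"
  shows "card (perp S) \<le> CARD('a) ^ card T * card (perp (S \<union> T))"
  using assms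
proof (induction T)
  case (insert a T)
  have "card (perp S) \<le> CARD('a) ^ card T * card (perp (S \<union> T))" using insert by simp
  also have "\<dots> \<le> CARD('a) ^ card T * (CARD('a) * card (perp (S \<union> insert a T)))"
    using card_perp_insert[of a "S \<union> T"] insert.prems by simp
  finally show ?case using insert.hyps by (simp add: mult_ac)
qed simp

text \<open>Each new vector divides the size of the orthogonal complement by at most \<open>q\<close>. Along a basis
  of \<open>V\<close> the size drops from \<open>q ^ (2 * d)\<close> to \<open>1\<close>, so every step divides by exactly \<open>q\<close>.\<close>

lemma card_perp_independent:
  assumes "independent B" "B \<subseteq> V"
  shows "card (perp B) = CARD('a) ^ (2 * d - card B)" "card B \<le> 2 * d"
proof -
  obtain B' where B': "B \<subseteq> B'" "B' \<subseteq> V" "independent B'" "V \<subseteq> span B'"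
    using maximal_independent_subset_extend[OF assms(2,1)] by blast
  have fin: "finite B'" using B'(2) finite_V finite_subset by blast
  have cB': "card B' = 2 * d" using basis_card_eq_dim[OF B'(2,4,3)] dim_V by simp
  show le: "card B \<le> 2 * d" using card_mono[OF fin B'(1)] cB' by simp
  have cd: "card (B' - B) = 2 * d - card B"
    using B'(1) fin cB' by (simp add: card_Diff_subset finite_subset)
  have "span B' = V" using B' span_minimal[OF B'(2) subspace_V] by auto
  then have "perp B' = perp V" using perp_span[OF B'(2)] by simp
  also have "\<dots> = {0}"
    using nondegenerate omega_zero subspace_0[OF subspace_V] by (auto simp: perp_def)
  finally have p1: "card (perp B') = 1" by simp
  have "B \<union> (B' - B) = B'" using B'(1) by auto
  then have up: "card (perp B) \<le> CARD('a) ^ (2 * d - card B)"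
    using card_perp_Un[of "B' - B" B] fin B'(2) assms(2) cd p1 by auto
  have "perp {} = V" by (auto simp: perp_def)
  then have "CARD('a) ^ (2 * d) \<le> CARD('a) ^ card B * card (perp B)"
    using card_perp_Un[of B "{}"] B'(1) fin finite_subset assms(2) card_V by auto
  moreover have "CARD('a) ^ (2 * d) = CARD('a) ^ card B * CARD('a) ^ (2 * d - card B)"
    using le by (simp flip: power_add)
  ultimately have "CARD('a) ^ (2 * d - card B) \<le> card (perp B)"
    using field_card_gt_1 by simp
  then show "card (perp B) = CARD('a) ^ (2 * d - card B)" using up by simp
qed

lemma isotropic_zero: "isotropic {0}"
  using subspace_V by (auto simp: isotropic_def omega_zero subspace_0)

lemma isotropic_subset_perp: "isotropic U \<Longrightarrow> U \<subseteq> perp U"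
  by (auto simp: isotropic_def perp_def)

lemma finite_isotropic: "isotropic U \<Longrightarrow> finite U"
  using finite_V finite_subset by (auto simp: isotropic_def)

lemma isotropic_subspace_of: "isotropic U \<Longrightarrow> W \<subseteq> U \<Longrightarrow> isotropic W \<longleftrightarrow> subspace W"
  by (auto simp: isotropic_def)

text \<open>In the converse direction the generators are pairwise orthogonal, so they lie in their
  own complement. The complement is a subspace and sees only the span of the generators, so the
  whole span lies in its own complement.\<close>

lemma isotropic_span_insert:
  assumes "S \<subseteq> V" "x \<in> V"
  shows "isotropic (span (insert x S)) \<longleftrightarrow> isotropic (span S) \<and> x \<in> perp (span S)"
proof
  assume iso: "isotropic (span (insert x S))"
  have sub: "span S \<subseteq> span (insert x S)" by (rule span_mono) auto
  have "x \<in> span (insert x S)" by (simp add: span_base)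
  then show "isotropic (span S) \<and> x \<in> perp (span S)"
    using isotropic_subspace_of[OF iso sub] iso sub assms by (auto simp: isotropic_def perp_def)
next
  assume a: "isotropic (span S) \<and> x \<in> perp (span S)"
  have ins: "insert x S \<subseteq> V" using assms by simp
  have "insert x S \<subseteq> perp (insert x S)"
  proof
    fix y assume y: "y \<in> insert x S"
    have "\<omega> y z = 0" if z: "z \<in> insert x S" for z
      using y z a assms alternating omega_commute_zero[of x y] span_base
      by (auto simp: isotropic_def perp_def)
    then show "y \<in> perp (insert x S)" using y ins by (auto simp: perp_def)
  qed
  moreover have "subspace (perp (insert x S))"
    using subspace_V ins by (auto simp: subspace_def perp_def omega_zero add_left scale_left subset_iff)
  ultimately have "span (insert x S) \<subseteq> perp (span (insert x S))"
    unfolding perp_span[OF ins] by (intro span_minimal)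
  then show "isotropic (span (insert x S))" by (auto simp: isotropic_def perp_def)
qed

definition isotropic_lists :: "nat \<Rightarrow> 'v list set" where
  "isotropic_lists m = {xs \<in> independent_lists V m. isotropic (span (set xs))}"

lemma isotropic_lists_Suc:
  "isotropic_lists (Suc m) =
    {x # xs |x xs. xs \<in> isotropic_lists m \<and> x \<in> perp (span (set xs)) - span (set xs)}"
  (is "?L = ?R")
proof (intro equalityI subsetI)
  fix ys assume "ys \<in> ?L"
  then obtain x xs where ys: "ys = x # xs" and xs: "xs \<in> independent_lists V m" "x \<in> V - span (set xs)"
    and iso: "isotropic (span (insert x (set xs)))"
    by (auto simp: isotropic_lists_def independent_lists_Suc)
  have "set xs \<subseteq> V" using xs by (simp add: independent_lists_def)
  then show "ys \<in> ?R" using isotropic_span_insert[of "set xs" x] ys xs iso by (auto simp: isotropic_lists_def)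
next
  fix ys assume "ys \<in> ?R"
  then obtain x xs where ys: "ys = x # xs" and xs: "xs \<in> isotropic_lists m"
    and x: "x \<in> perp (span (set xs)) - span (set xs)" by blast
  have "set xs \<subseteq> V" using xs by (simp add: isotropic_lists_def independent_lists_def)
  moreover have "x \<in> V" using x by (simp add: perp_def)
  ultimately show "ys \<in> ?L" using isotropic_span_insert[of "set xs" x] ys xs x
    by (auto simp: isotropic_lists_def independent_lists_Suc)
qed

text \<open>\<open>U\<close> lies in its own complement, which has size
  \<open>CARD('a) ^ (2 * d - dim U)\<close>.\<close>

lemma isotropic_dim_le:
  assumes "isotropic U"
  shows "dim U \<le> d"
proof -
  obtain B where B: "B \<subseteq> U" "independent B" "U \<subseteq> span B" "card B = dim U"
    using basis_exists by blast
  have U: "subspace U" "U \<subseteq> V" using assms by (auto simp: isotropic_def)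
  have BV: "B \<subseteq> V" using B U by auto
  have "span B = U" using B span_minimal[OF B(1) U(1)] by auto
  then have "U \<subseteq> perp B" using isotropic_subset_perp[OF assms] perp_span[OF BV] by simp
  then have "card U \<le> card (perp B)" by (rule card_mono[OF finite_perp])
  then have "CARD('a) ^ dim U \<le> CARD('a) ^ (2 * d - dim U)"
    using card_perp_independent[OF B(2) BV] card_subspace[OF U(1) finite_isotropic[OF assms]] B(4) by simp
  then have "dim U \<le> 2 * d - dim U" using field_card_gt_1 by simp
  then show ?thesis by linarith
qed

text \<open>A list of length \<open>k\<close> is extended by a vector of the complement outside the
  span; by isotropy the span is part of the complement, so the sizes may be subtracted.\<close>

lemma card_isotropic_lists:
  assumes "m \<le> d"
  shows "finite (isotropic_lists m) \<and>
    card (isotropic_lists m) = (\<Prod>i<m. CARD('a) ^ (2 * d - i) - CARD('a) ^ i)"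
proof (rule card_lists_by_extension[where n = d and E = "\<lambda>xs. perp (span (set xs)) - span (set xs)"])
  show "isotropic_lists 0 = {[]}"
    using isotropic_zero by (auto simp: isotropic_lists_def independent_lists_def independent_empty)
  fix k xs assume xs: "xs \<in> isotropic_lists k"
  then have il: "xs \<in> independent_lists V k" and iso: "isotropic (span (set xs))"
    by (auto simp: isotropic_lists_def)
  note D = independent_listsD[OF il]
  have S: "independent (set xs)" "set xs \<subseteq> V" "card (set xs) = k"
    using il by (auto simp: independent_lists_def distinct_card)
  have "card (perp (span (set xs))) = CARD('a) ^ (2 * d - k)"
    using perp_span[OF S(2)] card_perp_independent[OF S(1,2)] S(3) by simp
  then show "finite (perp (span (set xs)) - span (set xs)) \<and>
     card (perp (span (set xs)) - span (set xs)) = CARD('a) ^ (2 * d - k) - CARD('a) ^ k"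
    using D isotropic_subset_perp[OF iso] by (simp add: card_Diff_subset finite_perp)
qed (use assms isotropic_lists_Suc in auto)

lemma finite_isotropics: "finite {U. isotropic U \<and> P U}"
  by (rule finite_subset[of _ "Pow V"]) (auto simp: isotropic_def finite_V)

text \<open>Isotropic lists are the ordered bases of isotropic subspaces. The resulting identity is
  the one that \<open>split_poly\<close> satisfies.\<close>

lemma card_isotropic_of_dim:
  assumes "m \<le> d"
  shows "card {W. isotropic W \<and> dim W = m} * (\<Prod>i<m. CARD('a) ^ m - CARD('a) ^ i)
    = (\<Prod>i<m. CARD('a) ^ (2 * d - i) - CARD('a) ^ i)"
proof -
  let ?\<W> = "{W. isotropic W \<and> dim W = m}"
  have "isotropic_lists m = (\<Union>W\<in>?\<W>. independent_lists W m)"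
  proof (intro equalityI subsetI)
    fix xs assume xs: "xs \<in> isotropic_lists m"
    then have "span (set xs) \<in> ?\<W>" "xs \<in> independent_lists (span (set xs)) m"
      using independent_listsD(4) by (auto simp: isotropic_lists_def independent_lists_def span_base)
    then show "xs \<in> (\<Union>W\<in>?\<W>. independent_lists W m)" by blast
  next
    fix xs assume "xs \<in> (\<Union>W\<in>?\<W>. independent_lists W m)"
    then obtain W where W: "isotropic W" "dim W = m" "xs \<in> independent_lists W m" by blast
    then have "span (set xs) = W"
      using span_independent_list finite_isotropic by (auto simp: isotropic_def)
    then show "xs \<in> isotropic_lists m"
      using W by (auto simp: isotropic_lists_def independent_lists_def isotropic_def)
  qed
  then have "card (isotropic_lists m) = card ?\<W> * (\<Prod>i<m. CARD('a) ^ m - CARD('a) ^ i)"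
    by (intro card_subspaces_independent_lists)
      (auto simp: finite_isotropics finite_isotropic isotropic_def finite_V intro: finite_subset)
  then show ?thesis using card_isotropic_lists[OF assms] by simp
qed

end

section \<open>Weighted flags\<close>

text \<open>Since \<open>card\<close> is 0 on infinite sets, a coefficient is a true count only if
  its fibre is finite; the lemmas on convergence and on unions therefore assume finite
  fibres.\<close>

definition weight_series :: "('b \<Rightarrow> nat) \<Rightarrow> 'b set \<Rightarrow> rat fps" where
  "weight_series wt S = Abs_fps (\<lambda>n. of_nat (card {x \<in> S. wt x = n}))"

lemma weight_series_nth [simp]: "fps_nth (weight_series wt S) n = of_nat (card {x \<in> S. wt x = n})"
  by (simp add: weight_series_def)

text \<open>Formal power series converge coefficientwise, and the coefficient at \<open>n\<close> no
  longer changes once the partial sum includes the finite fibre over \<open>n\<close>.\<close>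

lemma weight_series_has_sum:
  assumes fin: "\<And>n. finite {x \<in> S. wt x = n}"
  shows "((\<lambda>x. fps_X ^ wt x) has_sum weight_series wt S) S"
  unfolding has_sum_def
proof (rule tendsto_fpsI)
  fix n
  let ?S = "{x \<in> S. wt x = n}"
  show "\<forall>\<^sub>F Y in finite_subsets_at_top S. fps_nth (\<Sum>x\<in>Y. fps_X ^ wt x) n = fps_nth (weight_series wt S) n"
    unfolding eventually_finite_subsets_at_top
  proof (intro exI[of _ ?S] conjI allI impI)
    fix Y assume Y: "finite Y \<and> ?S \<subseteq> Y \<and> Y \<subseteq> S"
    then have "?S = {x \<in> Y. n = wt x}" by auto
    then show "fps_nth (\<Sum>x\<in>Y. fps_X ^ wt x) n = fps_nth (weight_series wt S) n"
      using Y by (simp add: fps_sum_nth sum.If_cases Int_def)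
  qed (use fin in auto)
qed

lemma weight_series_UN:
  assumes "finite I" "\<And>n. finite {x \<in> (\<Union>i\<in>I. A i). wt x = n}"
    "\<And>i j. i \<in> I \<Longrightarrow> j \<in> I \<Longrightarrow> i \<noteq> j \<Longrightarrow> A i \<inter> A j = {}"
  shows "weight_series wt (\<Union>i\<in>I. A i) = (\<Sum>i\<in>I. weight_series wt (A i))"
proof (rule fps_ext)
  fix n
  have "{x \<in> (\<Union>i\<in>I. A i). wt x = n} = (\<Union>i\<in>I. {x \<in> A i. wt x = n})" by auto
  moreover have "card (\<Union>i\<in>I. {x \<in> A i. wt x = n}) = (\<Sum>i\<in>I. card {x \<in> A i. wt x = n})"
  proof (rule card_UN_disjoint[OF assms(1)])
    show "\<forall>i\<in>I. finite {x \<in> A i. wt x = n}"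
      by (auto intro: finite_subset[OF _ assms(2)[of n]])
    show "\<forall>i\<in>I. \<forall>j\<in>I. i \<noteq> j \<longrightarrow> {x \<in> A i. wt x = n} \<inter> {x \<in> A j. wt x = n} = {}"
      using assms(3) by blast
  qed
  ultimately show "fps_nth (weight_series wt (\<Union>i\<in>I. A i)) n = fps_nth (\<Sum>i\<in>I. weight_series wt (A i)) n"
    by (simp add: fps_sum_nth)
qed

lemma weight_series_shift:
  assumes "bij_betw f A B" "\<And>x. x \<in> A \<Longrightarrow> wt (f x) = wt x + k"
  shows "weight_series wt B = fps_X ^ k * weight_series wt A"
proof (rule fps_ext)
  fix n
  have B: "B = f ` A" and inj: "inj_on f A" using assms(1) by (auto simp: bij_betw_def)
  have "{y \<in> B. wt y = n} = f ` {x \<in> A. wt x + k = n}" using assms(2) B by auto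
  then have c: "card {y \<in> B. wt y = n} = card {x \<in> A. wt x + k = n}"
    using inj by (simp add: card_image inj_on_subset)
  show "fps_nth (weight_series wt B) n = fps_nth (fps_X ^ k * weight_series wt A) n"
  proof (cases "n < k")
    case True
    then have "{x \<in> A. wt x + k = n} = {}" by auto
    then have "card {x \<in> A. wt x + k = n} = 0" by (simp only: card.empty)
    with True c show ?thesis by (simp add: fps_X_power_mult_nth)
  next
    case False
    then have "{x \<in> A. wt x + k = n} = {x \<in> A. wt x = n - k}" by auto
    then show ?thesis using False c by (simp add: fps_X_power_mult_nth)
  qed
qed

section \<open>Flags sorted by their largest member\<close>

context finite_symplectic_space
begin

text \<open>With the value \<open>{0}\<close> for the empty flag, the strict inclusion
  \<open>top_space F \<subset> U\<close> also expresses that a newly appended \<open>U\<close> is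
  nonzero.\<close>

definition top_space :: "('v set \<times> nat) list \<Rightarrow> 'v set" where
  "top_space F = (if F = [] then {0} else fst (last F))"

lemma top_space_Nil [simp]: "top_space [] = {0}"
  and top_space_snoc [simp]: "top_space (F @ [(U, w)]) = U"
  by (simp_all add: top_space_def)

lemma flag_weight_Nil [simp]: "flag_weight [] = 0"
  and flag_weight_Cons [simp]: "flag_weight ((U, w) # F) = w * dim U + flag_weight F"
  and flag_weight_append [simp]: "flag_weight (F @ G) = flag_weight F + flag_weight G"
  by (simp_all add: flag_weight_def)

lemma zero_in_isotropic: "isotropic U \<Longrightarrow> {0} \<subseteq> U"
  by (auto simp: isotropic_def subspace_0)

lemma Nil_in_weighted_flags [simp]: "[] \<in> weighted_flags"
  by (simp add: weighted_flags_def flag_def)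

lemma weighted_flags_snoc:
  "F @ [(U, w)] \<in> weighted_flags \<longleftrightarrow>
     F \<in> weighted_flags \<and> isotropic U \<and> top_space F \<subset> U \<and> 0 < w"
proof (cases F rule: rev_cases)
  case Nil
  then show ?thesis using zero_in_isotropic[of U]
    by (auto simp: weighted_flags_def flag_def)
next
  case (snoc F' p)
  obtain U' w' where p: "p = (U', w')" by (cases p)
  have "U \<noteq> {0}" if "U' \<noteq> {0}" "isotropic U'" "U' \<subset> U"
    using that zero_in_isotropic[of U'] by auto
  then show ?thesis unfolding snoc p top_space_snoc
    by (simp add: weighted_flags_def flag_def sorted_wrt_append) (blast intro: psubset_trans)
qed

lemma isotropic_top_space: "F \<in> weighted_flags \<Longrightarrow> isotropic (top_space F)"
  by (cases F rule: rev_cases) (auto simp: isotropic_zero weighted_flags_snoc)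

lemma dim_pos:
  assumes "isotropic U" "{0} \<subset> U"
  shows "0 < dim U"
proof (rule ccontr)
  assume "\<not> 0 < dim U"
  then have "card U = 1"
    using card_subspace[of U] assms finite_isotropic by (simp add: isotropic_def)
  then show False using assms(2) by (metis card_1_singletonE psubset_imp_subset less_irrefl singleton_insert_inj_eq subset_singletonD insert_not_empty)
qed

lemma top_space_nonzero:
  assumes "F \<in> weighted_flags" "F \<noteq> []"
  shows "{0} \<subset> top_space F"
  using assms
proof (cases F rule: rev_cases)
  case (snoc F' p)
  obtain U w where p: "p = (U, w)" by (cases p)
  then show ?thesis using assms snoc zero_in_isotropic[OF isotropic_top_space[of F']]
    by (auto simp: weighted_flags_snoc)
qed simp

text \<open>Every member has positive dimension and positive weight, so it contributes at least its
  own weight, and at least 1, to the total. This leaves finitely many flags of a given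
  weight.\<close>

lemma flag_bounds:
  assumes "F \<in> weighted_flags"
  shows "length F \<le> flag_weight F \<and> set F \<subseteq> Pow V \<times> {..flag_weight F}"
  using assms
proof (induction F rule: rev_induct)
  case (snoc p F)
  obtain U w where p: "p = (U, w)" by (cases p)
  have F: "F \<in> weighted_flags" "isotropic U" "top_space F \<subset> U" "0 < w"
    using snoc.prems by (auto simp: p weighted_flags_snoc)
  have "{0} \<subset> U" using F zero_in_isotropic[OF isotropic_top_space[OF F(1)]] by auto
  then have "0 < dim U" using dim_pos F by blast
  then have "w \<le> w * dim U" by simp
  moreover have "U \<subseteq> V" using F by (simp add: isotropic_def)
  moreover have IH: "length F \<le> flag_weight F" "set F \<subseteq> Pow V \<times> {..flag_weight F}"
    using snoc.IH[OF F(1)] by auto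
  ultimately have "Suc (length F) \<le> flag_weight F + w * dim U" "w \<le> flag_weight F + w * dim U"
    using F(4) by linarith+
  moreover have "set F \<subseteq> Pow V \<times> {..flag_weight F + w * dim U}" using IH(2) by fastforce
  ultimately show ?case using \<open>U \<subseteq> V\<close> by (simp add: p)
qed simp

lemma finite_weighted_flags: "finite {F \<in> weighted_flags. flag_weight F = n}"
proof (rule finite_subset)
  show "{F \<in> weighted_flags. flag_weight F = n} \<subseteq> {F. set F \<subseteq> Pow V \<times> {..n} \<and> length F \<le> n}"
    using flag_bounds by blast
  show "finite {F. set F \<subseteq> Pow V \<times> {..n} \<and> length F \<le> n}"
    by (rule finite_lists_length_le) (simp add: finite_V)
qed

definition flags_to :: "'v set \<Rightarrow> ('v set \<times> nat) list set" where
  "flags_to U = {F \<in> weighted_flags. top_space F = U}"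

text \<open>The weight series of this set is \<open>H\<^sub>n\<close> for \<open>n = dim U\<close>;
  the empty flag is included.\<close>

definition flags_below :: "'v set \<Rightarrow> ('v set \<times> nat) list set" where
  "flags_below U = {F \<in> weighted_flags. top_space F \<subseteq> U}"

lemma flags_below_zero: "flags_below {0} = {[]}"
proof -
  have "F = []" if "F \<in> weighted_flags" "top_space F \<subseteq> {0}" for F
    using top_space_nonzero[OF that(1)] that(2) by blast
  then show ?thesis by (auto simp: flags_below_def)
qed

text \<open>With each member repeated as often as its weight says, this adds one more copy of
  \<open>U\<close> at the top: the weight of \<open>U\<close> grows by 1, or \<open>U\<close> enters
  with weight 1.\<close>

definition raise_weight :: "'v set \<Rightarrow> ('v set \<times> nat) list \<Rightarrow> ('v set \<times> nat) list" where
  "raise_weight U F = (if top_space F = U then butlast F @ [(U, Suc (snd (last F)))] else F @ [(U, 1)])"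

definition lower_weight :: "('v set \<times> nat) list \<Rightarrow> ('v set \<times> nat) list" where
  "lower_weight F = (if snd (last F) = 1 then butlast F
     else butlast F @ [(fst (last F), snd (last F) - 1)])"

text \<open>Removing one copy of the top member undoes adding one. As \<open>U\<close> is not
  \<open>{0}\<close>, the empty flag falls into the branch that appends \<open>U\<close>.\<close>

lemma raise_weight_bij:
  assumes U: "isotropic U" "{0} \<subset> U"
  shows "bij_betw (raise_weight U) (flags_below U) (flags_to U)"
proof (rule bij_betw_byWitness[where f' = lower_weight])
  show "\<forall>F\<in>flags_below U. lower_weight (raise_weight U F) = F"
  proof
    fix F assume F: "F \<in> flags_below U"
    show "lower_weight (raise_weight U F) = F"
    proof (cases F rule: rev_cases)
      case Nil
      then show ?thesis using U by (auto simp: raise_weight_def lower_weight_def)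
    next
      case (snoc F' p)
      obtain U' w where p: "p = (U', w)" by (cases p)
      have "0 < w" using F by (simp add: snoc p flags_below_def weighted_flags_snoc)
      then show ?thesis by (simp add: snoc p raise_weight_def lower_weight_def butlast_append)
    qed
  qed
  show "\<forall>F\<in>flags_to U. raise_weight U (lower_weight F) = F"
  proof
    fix F assume F: "F \<in> flags_to U"
    show "raise_weight U (lower_weight F) = F"
    proof (cases F rule: rev_cases)
      case Nil
      then show ?thesis using F U by (auto simp: flags_to_def)
    next
      case (snoc F' p)
      obtain U' w where p: "p = (U', w)" by (cases p)
      have "U' = U" "0 < w" "top_space F' \<noteq> U"
        using F by (auto simp: snoc p flags_to_def weighted_flags_snoc)
      then show ?thesis by (auto simp: snoc p raise_weight_def lower_weight_def)
    qed
  qed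
  show "raise_weight U ` flags_below U \<subseteq> flags_to U"
  proof (rule image_subsetI)
    fix F assume F: "F \<in> flags_below U"
    show "raise_weight U F \<in> flags_to U"
    proof (cases "top_space F = U")
      case False
      then show ?thesis using F U by (auto simp: raise_weight_def flags_to_def flags_below_def weighted_flags_snoc)
    next
      case True
      then have "F \<noteq> []" using U by auto
      then obtain F' U' w where "F = F' @ [(U', w)]" by (metis rev_exhaust surj_pair)
      then show ?thesis using True F by (auto simp: raise_weight_def flags_to_def flags_below_def weighted_flags_snoc)
    qed
  qed
  show "lower_weight ` flags_to U \<subseteq> flags_below U"
  proof (rule image_subsetI)
    fix F assume F: "F \<in> flags_to U"
    then have "F \<noteq> []" using U by (auto simp: flags_to_def)
    then obtain F' U' w where "F = F' @ [(U', w)]" by (metis rev_exhaust surj_pair)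
    then show "lower_weight F \<in> flags_below U"
      using F by (auto simp: lower_weight_def flags_to_def flags_below_def weighted_flags_snoc)
  qed
qed

lemma flag_weight_raise:
  assumes "{0} \<subset> U"
  shows "flag_weight (raise_weight U F) = flag_weight F + dim U"
proof (cases F rule: rev_cases)
  case Nil
  then show ?thesis using assms by (auto simp: raise_weight_def)
next
  case (snoc F' p)
  then show ?thesis by (cases p) (simp add: raise_weight_def)
qed

text \<open>One more copy of \<open>U\<close> costs \<open>dim U\<close>. For \<open>U = {0}\<close>
  there is nothing to add, and both sets contain just the empty flag.\<close>

lemma weight_series_flags_to:
  assumes "isotropic U"
  shows "weight_series flag_weight (flags_to U) = fps_X ^ dim U * weight_series flag_weight (flags_below U)"
proof (cases "U = {0}")
  case True
  have "flags_to {0} \<subseteq> flags_below {0}" "[] \<in> flags_to {0}"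
    by (simp_all add: flags_to_def flags_below_def subset_iff)
  then have "flags_to {0} = {[]}" unfolding flags_below_zero by blast
  moreover note flags_below_zero
  moreover have "dim {0} = 0" using dim_span[of "{}"] dim_eq_card_independent[OF independent_empty] by simp
  ultimately show ?thesis using True by simp
next
  case False
  then have U: "{0} \<subset> U" using zero_in_isotropic[OF assms] by auto
  show ?thesis
    by (rule weight_series_shift[OF raise_weight_bij[OF assms U]]) (rule flag_weight_raise[OF U])
qed

lemma weight_series_by_top:
  assumes "\<W> \<subseteq> {W. isotropic W}"
  shows "weight_series flag_weight {F \<in> weighted_flags. top_space F \<in> \<W>} =
     (\<Sum>W\<in>\<W>. fps_X ^ dim W * weight_series flag_weight (flags_below W))"
proof -
  have fin: "finite \<W>" using assms finite_isotropics[of "\<lambda>_. True"] finite_subset by auto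
  have eq: "{F \<in> weighted_flags. top_space F \<in> \<W>} = (\<Union>W\<in>\<W>. flags_to W)"
    by (auto simp: flags_to_def)
  have "weight_series flag_weight (\<Union>W\<in>\<W>. flags_to W) = (\<Sum>W\<in>\<W>. weight_series flag_weight (flags_to W))"
  proof (rule weight_series_UN[OF fin])
    show "finite {F \<in> (\<Union>W\<in>\<W>. flags_to W). flag_weight F = n}" for n
      by (rule finite_subset[OF _ finite_weighted_flags[of n]]) (auto simp: flags_to_def)
  qed (auto simp: flags_to_def)
  then show ?thesis unfolding eq using assms weight_series_flags_to by (auto intro: sum.cong)
qed

lemma Q_power_neq_1: "0 < n \<Longrightarrow> of_nat CARD('a) ^ n \<noteq> (1 :: rat fps)"
proof -
  assume "0 < n"
  then have "CARD('a) ^ n \<noteq> 1" using field_card_gt_1 by simp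
  then show ?thesis by (metis of_nat_1 of_nat_eq_iff of_nat_power)
qed

text \<open>The passage from natural numbers to power series: \<open>i \<le> e i\<close> makes the
  truncated differences exact, and the common product is cancelled. The exponent \<open>e\<close> is
  constant for subspaces of a given space and \<open>2 * d - i\<close> for isotropic ones.\<close>

lemma of_nat_eq_if_prod_eq:
  fixes c :: nat and r :: "rat fps"
  assumes c: "c * (\<Prod>i<m. CARD('a) ^ m - CARD('a) ^ i) = (\<Prod>i<m. CARD('a) ^ e i - CARD('a) ^ i)"
    and r: "r * (\<Prod>i<m. of_nat CARD('a) ^ m - of_nat CARD('a) ^ i) = (\<Prod>i<m. of_nat CARD('a) ^ e i - of_nat CARD('a) ^ i)"
    and e: "\<And>i. i < m \<Longrightarrow> i \<le> e i"
  shows "of_nat c = r"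
proof -
  have diff: "(of_nat (\<Prod>i<m. CARD('a) ^ f i - CARD('a) ^ i) :: rat fps) = (\<Prod>i<m. of_nat CARD('a) ^ f i - of_nat CARD('a) ^ i)"
    if "\<And>i. i < m \<Longrightarrow> i \<le> f i" for f
  proof -
    have "CARD('a) ^ i \<le> CARD('a) ^ f i" if "i < m" for i
      using \<open>\<And>i. i < m \<Longrightarrow> i \<le> f i\<close>[OF that] field_card_gt_1 by (intro power_increasing) auto
    then show ?thesis by (simp add: of_nat_diff)
  qed
  have "(of_nat c :: rat fps) * (\<Prod>i<m. of_nat CARD('a) ^ m - of_nat CARD('a) ^ i) = of_nat (c * (\<Prod>i<m. CARD('a) ^ m - CARD('a) ^ i))"
    unfolding of_nat_mult by (subst diff) simp_all
  also have "\<dots> = r * (\<Prod>i<m. of_nat CARD('a) ^ m - of_nat CARD('a) ^ i)"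
    unfolding c r by (rule diff[OF e])
  finally show ?thesis
    using prod_power_diff_nonzero[of "of_nat CARD('a) :: rat fps" m] Q_power_neq_1 by simp
qed

lemma card_subspaces_gaussian:
  assumes "isotropic U" "m \<le> dim U"
  shows "of_nat (card {W. isotropic W \<and> W \<subseteq> U \<and> dim W = m}) = (gaussian (of_nat CARD('a)) (dim U) m :: rat fps)"
proof -
  have "{W. isotropic W \<and> W \<subseteq> U \<and> dim W = m} = {W. subspace W \<and> W \<subseteq> U \<and> dim W = m}"
    using isotropic_subspace_of[OF assms(1)] by blast
  moreover have "card {W. subspace W \<and> W \<subseteq> U \<and> dim W = m} * (\<Prod>i<m. CARD('a) ^ m - CARD('a) ^ i)
    = (\<Prod>i<m. CARD('a) ^ dim U - CARD('a) ^ i)"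
    using assms finite_isotropic[OF assms(1)] by (intro card_subspaces_of_dim) (auto simp: isotropic_def)
  ultimately show ?thesis
    using of_nat_eq_if_prod_eq[where e = "\<lambda>_. dim U", OF _ gaussian_eq] assms(2) by simp
qed

lemma card_isotropic_split_poly:
  assumes "m \<le> d"
  shows "of_nat (card {W. isotropic W \<and> dim W = m}) = (split_poly (of_nat CARD('a)) d m :: rat fps)"
  by (rule of_nat_eq_if_prod_eq[where e = "\<lambda>i. 2 * d - i", OF card_isotropic_of_dim[OF assms] split_poly_eq[OF assms]])
    (use assms in simp)

end

section \<open>Products of geometric series\<close>

definition euler_series :: "nat \<Rightarrow> rat fps" where
  "euler_series k = (\<Prod>j=1..k. 1 / (1 - fps_X ^ j))"

lemma one_minus_X_power_inverse:
  assumes "0 < j"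
  shows "(1 - fps_X ^ j) * (1 / (1 - fps_X ^ j)) = (1 :: rat fps)"
proof -
  have "fps_nth (1 - fps_X ^ j :: rat fps) 0 \<noteq> 0" using assms by (simp add: fps_X_power_nth)
  then show ?thesis by (simp add: fps_divide_unit inverse_mult_eq_1')
qed

text \<open>This is where the factors left by the cuts of a word meet the denominators of the flag
  series: they cancel those with index above \<open>m\<close>.\<close>

lemma euler_series_truncate:
  assumes "m \<le> n"
  shows "(\<Prod>j=Suc m..n. 1 - fps_X ^ j) * euler_series n = euler_series m"
proof -
  have "euler_series n = euler_series m * (\<Prod>j=Suc m..n. 1 / (1 - fps_X ^ j))"
    using assms prod.ub_add_nat[of 1 m "\<lambda>j. 1 / (1 - fps_X ^ j) :: rat fps" "n - m"] by (simp add: euler_series_def)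
  moreover have "(\<Prod>j=Suc m..n. 1 - fps_X ^ j) * (\<Prod>j=Suc m..n. 1 / (1 - fps_X ^ j)) = (1 :: rat fps)"
    unfolding prod.distrib[symmetric] by (rule prod.neutral) (use one_minus_X_power_inverse in auto)
  ultimately show ?thesis by (simp add: mult.left_commute)
qed

section \<open>Comparison of the two recursions\<close>

context finite_symplectic_space
begin

text \<open>Strong induction on the dimension. Grouped by the dimension of the top member, the flags
  inside \<open>U\<close> satisfy the recursion of the word polynomial multiplied by
  \<open>euler_series (dim U)\<close>.\<close>

lemma weight_series_flags_below:
  assumes "isotropic U"
  shows "weight_series flag_weight (flags_below U) = word_poly (of_nat CARD('a)) fps_X {1..int (dim U)} * euler_series (dim U)"
  using assms
proof (induction "dim U" arbitrary: U rule: less_induct)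
  case less
  let ?n = "dim U"
  let ?p = "\<lambda>m. word_poly (of_nat CARD('a)) (fps_X :: rat fps) {1..int m}"
  let ?H = "\<lambda>U. weight_series flag_weight (flags_below U)"
  let ?\<W> = "\<lambda>m. {W. isotropic W \<and> W \<subseteq> U \<and> dim W = m}"
  have finU: "finite U" using finite_isotropic less.prems by blast
  have dim_less: "dim W < ?n" if W: "isotropic W" "W \<subset> U" for W
  proof -
    have "card W < card U" using psubset_card_mono[OF finU W(2)] .
    then have "CARD('a) ^ dim W < CARD('a) ^ ?n"
      using card_subspace[of U] card_subspace[of W] W less.prems finU finite_isotropic
      by (simp add: isotropic_def)
    then show ?thesis using field_card_gt_1 by simp
  qed
  have "flags_below U = {F \<in> weighted_flags. top_space F \<in> {W. isotropic W \<and> W \<subseteq> U}}"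
    using isotropic_top_space by (auto simp: flags_below_def)
  then have "?H U = (\<Sum>W | isotropic W \<and> W \<subseteq> U. fps_X ^ dim W * ?H W)"
    using weight_series_by_top[of "{W. isotropic W \<and> W \<subseteq> U}"] by auto
  \<comment> \<open>The summand for \<open>W = U\<close> contains the unknown series and will go to
    the left; all other \<open>W\<close> have smaller dimension.\<close>
  also have "{W. isotropic W \<and> W \<subseteq> U} = insert U {W. isotropic W \<and> W \<subset> U}"
    using less.prems by auto
  also have "(\<Sum>W\<in>\<dots>. fps_X ^ dim W * ?H W) =
      fps_X ^ ?n * ?H U + (\<Sum>W | isotropic W \<and> W \<subset> U. fps_X ^ dim W * ?H W)"
    by (rule sum.insert) (auto simp: finite_isotropics)
  also have "(\<Sum>W | isotropic W \<and> W \<subset> U. fps_X ^ dim W * ?H W) =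
     (\<Sum>W | isotropic W \<and> W \<subset> U. fps_X ^ dim W * (?p (dim W) * euler_series (dim W)))"
    by (rule sum.cong) (use less.hyps dim_less in auto)
  also have "\<dots> = (\<Sum>m<?n. \<Sum>W\<in>{W \<in> {W. isotropic W \<and> W \<subset> U}. dim W = m}.
      fps_X ^ dim W * (?p (dim W) * euler_series (dim W)))"
    by (rule sum.group[symmetric]) (use dim_less in \<open>auto simp: finite_isotropics\<close>)
  also have "\<dots> = (\<Sum>m<?n. gaussian (of_nat CARD('a)) ?n m * (fps_X ^ m * (?p m * euler_series m)))"
  proof (rule sum.cong)
    fix m assume m: "m \<in> {..<?n}"
    then have "{W \<in> {W. isotropic W \<and> W \<subset> U}. dim W = m} = ?\<W> m" by auto
    then show "(\<Sum>W\<in>{W \<in> {W. isotropic W \<and> W \<subset> U}. dim W = m}.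
        fps_X ^ dim W * (?p (dim W) * euler_series (dim W)))
      = gaussian (of_nat CARD('a)) ?n m * (fps_X ^ m * (?p m * euler_series m))"
      using card_subspaces_gaussian[OF less.prems, of m] m by simp
  qed simp
  finally have H: "(1 - fps_X ^ ?n) * ?H U = (\<Sum>m<?n. gaussian (of_nat CARD('a)) ?n m * (fps_X ^ m * (?p m * euler_series m)))"
    unfolding left_diff_distrib mult_1_left diff_eq_eq add.commute[of _ "fps_X ^ ?n * ?H U"] .
  \<comment> \<open>Dimension 0 is separate, because \<open>1 - fps_X ^ 0\<close> is zero and cannot
    be cancelled.\<close>
  show ?case
  proof (cases "?n = 0")
    case True
    then have "\<not> {0} \<subset> U" using dim_pos[OF less.prems] by (metis less_irrefl)
    then have "U = {0}" using zero_in_isotropic[OF less.prems] by auto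
    then have "flags_below U = {[]}" by (simp add: flags_below_zero)
    moreover have "weight_series flag_weight {[]} = 1"
    proof (rule fps_ext)
      fix n
      have "{x \<in> {[] :: ('v set \<times> nat) list}. flag_weight x = n} = (if n = 0 then {[]} else {})" by auto
      then show "fps_nth (weight_series flag_weight {[]}) n = fps_nth 1 n" by simp
    qed
    ultimately show ?thesis using True
      by (simp add: word_poly_def euler_series_def)
  next
    case False
    let ?T = "{1..int ?n}"
    have "word_poly (of_nat CARD('a)) (fps_X :: rat fps) B = ?p (card B)" if "B \<subset> ?T" for B
      using that finite_subset[of B ?T] by (intro word_poly_card Q_power_neq_1 fps_X_power_neq_1) auto
    from word_poly_card_recursion[of "of_nat CARD('a)" ?T "fps_X :: rat fps", OF _ Q_power_neq_1 _ this]
    have P: "(1 - fps_X ^ ?n) * ?p ?n =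
      (\<Sum>m<?n. gaussian (of_nat CARD('a)) ?n m * fps_X ^ m * ?p m * (\<Prod>j=Suc m..?n. 1 - fps_X ^ j))"
      by simp
    have "(1 - fps_X ^ ?n) * (?p ?n * euler_series ?n) =
      (\<Sum>m<?n. gaussian (of_nat CARD('a)) ?n m * fps_X ^ m * ?p m * (\<Prod>j=Suc m..?n. 1 - fps_X ^ j)) * euler_series ?n"
      unfolding mult.assoc[symmetric] P ..
    also have "\<dots> = (\<Sum>m<?n. gaussian (of_nat CARD('a)) ?n m * (fps_X ^ m * (?p m * euler_series m)))"
      unfolding sum_distrib_right
      by (rule sum.cong) (simp_all add: mult.assoc euler_series_truncate)
    finally have "(1 - fps_X ^ ?n) * ?H U = (1 - fps_X ^ ?n) * (?p ?n * euler_series ?n)"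
      using H by simp
    moreover have "(1 - fps_X ^ ?n :: rat fps) \<noteq> 0" using fps_X_power_neq_1[of ?n] False by simp
    ultimately show ?thesis by simp
  qed
qed

text \<open>Here the top member ranges over all isotropic subspaces, so \<open>split_poly\<close>
  takes the place of the Gaussian binomials, and the known series of flags below each of them can be
  inserted directly.\<close>

lemma weighted_flags_has_sum:
  "((\<lambda>F. fps_X ^ flag_weight F) has_sum (M_signed CARD('a) d * euler_series d)) weighted_flags"
proof -
  let ?p = "\<lambda>m. word_poly (of_nat CARD('a)) (fps_X :: rat fps) {1..int m}"
  have "{F \<in> weighted_flags. top_space F \<in> {W. isotropic W}} = weighted_flags"
    using isotropic_top_space by auto
  then have "weight_series flag_weight weighted_flags =
     (\<Sum>W | isotropic W. fps_X ^ dim W * weight_series flag_weight (flags_below W))"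
    using weight_series_by_top[of "{W. isotropic W}"] by simp
  also have "\<dots> = (\<Sum>W | isotropic W. fps_X ^ dim W * (?p (dim W) * euler_series (dim W)))"
    by (rule sum.cong) (auto simp: weight_series_flags_below)
  also have "\<dots> = (\<Sum>m\<le>d. \<Sum>W\<in>{W \<in> {W. isotropic W}. dim W = m}. fps_X ^ dim W * (?p (dim W) * euler_series (dim W)))"
    by (rule sum.group[symmetric]) (use isotropic_dim_le finite_isotropics[of "\<lambda>_. True"] in auto)
  also have "\<dots> = (\<Sum>m\<le>d. split_poly (of_nat CARD('a)) d m * (fps_X ^ m * (?p m * euler_series m)))"
    by (rule sum.cong) (simp_all add: card_isotropic_split_poly)
  also have "\<dots> = (\<Sum>m\<le>d. split_poly (of_nat CARD('a)) d m * fps_X ^ m * ?p m * (\<Prod>j=Suc m..d. 1 - fps_X ^ j)) * euler_series d"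
    unfolding sum_distrib_right
    by (rule sum.cong) (simp_all add: mult.assoc euler_series_truncate)
  also have "\<dots> = M_signed CARD('a) d * euler_series d"
    using M_signed_expansion[of "CARD('a)" d] field_card_gt_1 by simp
  finally show ?thesis
    using weight_series_has_sum[of weighted_flags flag_weight, OF finite_weighted_flags] by simp
qed

end

theorem theorem3p2:
  fixes scale :: "'a::{field,finite} \<Rightarrow> 'v::ab_group_add \<Rightarrow> 'v"
    and V :: "'v set" and \<omega> :: "'v \<Rightarrow> 'v \<Rightarrow> 'a" and d q :: nat
  assumes "q = CARD('a)" and "odd q"
    and "symplectic_space scale V \<omega> d"
  shows "((\<lambda>F. fps_X ^ symplectic_space.flag_weight scale F) has_sum
           (M_signed q d * (\<Prod>j=1..d. 1 / (1 - fps_X ^ j))))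
         (symplectic_space.weighted_flags scale V \<omega>)"
proof -
  interpret finite_symplectic_space scale V \<omega> d
    by (intro finite_symplectic_space.intro finite_field_space.intro assms(3)
        symplectic_space.axioms(1)[OF assms(3)])
  show ?thesis
    using weighted_flags_has_sum unfolding euler_series_def assms(1) .
qed

end
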